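(* Let $\mathbb{S}^{12}(\mathbb{R}^2)$ be the space of totally symmetric tensors of order $12$ on $\mathbb{R}^2$, and write $\mathbf{S}=(\lambda,z_2,z_4,z_6,z_8,z_{10},z_{12})$, $\lambda\in\mathbb{R}$, $z_k\in\mathbb{C}$, in a fixed explicit harmonic decomposition $\mathbb{S}^{12}(\mathbb{R}^2)\simeq\mathbb{H}^0\oplus\mathbb{H}^2\oplus\mathbb{H}^4\oplus\mathbb{H}^6\oplus\mathbb{H}^8\oplus\mathbb{H}^{10}\oplus\mathbb{H}^{12}$. Let $\mathcal{L}$ be the following list of $102$ monomials: degree 3: $z_4\overline{z}_2^2$, $z_8\overline{z}_4^2$, $z_{12}\overline{z}_6^2$, $z_{12}\overline{z}_{10}\overline{z}_2$, $z_6\overline{z}_2\overline{z}_4$, $z_8\overline{z}_2\overline{z}_6$, $z_{10}\overline{z}_4\overline{z}_6$, $z_{10}\overline{z}_2\overline{z}_8$, $z_{12}\overline{z}_4\overline{z}_8$; degree 4: $z_6\overline{z}_2^3$, $z_{12}\overline{z}_4^3$, $z_6^2\overline{z}_{10}\overline{z}_2$, $z_8^2\overline{z}_{12}\overline{z}_4$, $z_8\overline{z}_2^2\overline{z}_4$, $z_{10}\overline{z}_2\overline{z}_4^2$, $z_4^2\overline{z}_2\overline{z}_6$, $z_{10}\overline{z}_2^2\overline{z}_6$, $z_{10}^2\overline{z}_{12}\overline{z}_8$, $z_{12}\overline{z}_2^2\overline{z}_8$, $z_6^2\overline{z}_4\overline{z}_8$, $z_8^2\overline{z}_{10}\overline{z}_6$,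 $z_4z_8\overline{z}_{10}\overline{z}_2$, $z_{10}z_4\overline{z}_{12}\overline{z}_2$, $z_6z_8\overline{z}_{12}\overline{z}_2$, $z_6z_8\overline{z}_{10}\overline{z}_4$, $z_{10}z_6\overline{z}_{12}\overline{z}_4$, $z_{10}z_8\overline{z}_{12}\overline{z}_6$, $z_{12}\overline{z}_2\overline{z}_4\overline{z}_6$, $z_4z_6\overline{z}_2\overline{z}_8$; degree 5: $z_8\overline{z}_2^4$, $z_6^2\overline{z}_4^3$, $z_{12}^2\overline{z}_8^3$, $z_4^3\overline{z}_{10}\overline{z}_2$, $z_8^2\overline{z}_{12}\overline{z}_2^2$, $z_{12}^2\overline{z}_{10}^2\overline{z}_4$, $z_{10}\overline{z}_2^3\overline{z}_4$, $z_{10}^2\overline{z}_{12}\overline{z}_4^2$, $z_{12}\overline{z}_2^2\overline{z}_4^2$, $z_{12}\overline{z}_2^3\overline{z}_6$, $z_{10}z_8\overline{z}_6^3$, $z_6^2\overline{z}_2^2\overline{z}_8$, $z_{10}^2\overline{z}_6^2\overline{z}_8$, $z_{10}^2\overline{z}_4\overline{z}_8^2$, $z_8^2\overline{z}_4\overline{z}_6^2$, $z_4^2z_6\overline{z}_{12}\overline{z}_2$, $z_6z_8\overline{z}_{10}\overline{z}_2^2$, $z_{10}z_6\overline{z}_{12}\overline{z}_2^2$, $z_8^2\overline{z}_{10}\overline{z}_2\overline{z}_4$, $z_{12}z_6\overline{z}_{10}\overline{z}_4^2$, $z_{10}^2\overline{z}_{12}\overline{z}_2\overline{z}_6$, $z_{10}z_4\overline{z}_2\overline{z}_6^2$,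 $z_{10}z_6\overline{z}_4^2\overline{z}_8$, $z_{12}^2\overline{z}_{10}\overline{z}_6\overline{z}_8$, $z_{12}z_6\overline{z}_2\overline{z}_8^2$, $z_{10}z_{12}\overline{z}_6\overline{z}_8^2$, $z_{10}z_8\overline{z}_{12}\overline{z}_2\overline{z}_4$, $z_{12}z_8\overline{z}_{10}\overline{z}_4\overline{z}_6$, $z_{12}z_4\overline{z}_2\overline{z}_6\overline{z}_8$; degree 6: $z_{10}\overline{z}_2^5$, $z_8^2\overline{z}_{10}\overline{z}_2^3$, $z_8^3\overline{z}_{10}^2\overline{z}_4$, $z_{12}\overline{z}_2^4\overline{z}_4$, $z_{10}^3\overline{z}_{12}^2\overline{z}_6$, $z_6^3\overline{z}_{10}\overline{z}_4^2$, $z_8^3\overline{z}_{12}\overline{z}_6^2$, $z_{10}^2\overline{z}_2\overline{z}_6^3$, $z_{10}^2\overline{z}_4^3\overline{z}_8$, $z_6^3\overline{z}_2\overline{z}_8^2$, $z_{10}z_6\overline{z}_4^4$, $z_6z_8^2\overline{z}_{10}^2\overline{z}_2$, $z_8^3\overline{z}_{10}\overline{z}_{12}\overline{z}_2$, $z_{10}^2z_6\overline{z}_{12}^2\overline{z}_2$, $z_{10}z_8\overline{z}_{12}\overline{z}_2^3$, $z_{10}z_8^2\overline{z}_{12}^2\overline{z}_2$, $z_{12}z_6^2\overline{z}_{10}^2\overline{z}_4$, $z_{10}^2z_8\overline{z}_{12}^2\overline{z}_4$, $z_{10}^2\overline{z}_{12}\overline{z}_2^2\overline{z}_4$, $z_{12}^2\overline{z}_{10}\overline{z}_4^2\overline{z}_6$,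 $z_{12}^2\overline{z}_2\overline{z}_6\overline{z}_8^2$; degree 7: $z_{12}\overline{z}_2^6$, $z_8^3\overline{z}_6^4$, $z_{10}^2\overline{z}_4^5$, $z_{10}^2\overline{z}_{12}\overline{z}_2^4$, $z_6^4\overline{z}_{10}^2\overline{z}_4$, $z_{12}^3\overline{z}_{10}^3\overline{z}_6$, $z_{10}^3\overline{z}_{12}\overline{z}_6^3$, $z_{12}^3\overline{z}_{10}^2\overline{z}_8^2$, $z_{10}^3\overline{z}_6\overline{z}_8^3$, $z_{10}^2z_{12}\overline{z}_8^4$, $z_8^3\overline{z}_{10}^2\overline{z}_2^2$, $z_{10}^2z_8\overline{z}_{12}^2\overline{z}_2^2$, $z_{10}^3\overline{z}_{12}^2\overline{z}_2\overline{z}_4$; degree 8: $z_{10}^3\overline{z}_6^5$, $z_8^4\overline{z}_{10}^3\overline{z}_2$, $z_{10}^4\overline{z}_{12}^3\overline{z}_4$, $z_{10}^3\overline{z}_{12}^2\overline{z}_2^3$, $z_{10}^3z_8\overline{z}_{12}^3\overline{z}_2$; degree 9: $z_{10}^4\overline{z}_8^5$, $z_{10}^4\overline{z}_{12}^3\overline{z}_2^2$, $z_{12}^4\overline{z}_{10}^4\overline{z}_8$; degree 10: $z_{10}^5\overline{z}_{12}^4\overline{z}_2$; degree 11: $z_{12}^5\overline{z}_{10}^6$. Then: (1) a minimal integrity basis for $\mathrm{Inv}(\mathbb{S}^{12}(\mathbb{R}^2),\mathrm{SO}(2))$ consists of the $211$ invariants: $\lambda$, $z_k\overline{z}_k$ for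 $k\in\{2,4,6,8,10,12\}$, and $\mathrm{Re}(\mathbf{m})$, $\mathrm{Im}(\mathbf{m})$ for $\mathbf{m}\in\mathcal{L}$; (2) a minimal integrity basis for $\mathrm{Inv}(\mathbb{S}^{12}(\mathbb{R}^2),\mathrm{O}(2))$ consists of the $113$ invariants: $\lambda$, $z_k\overline{z}_k$ for $k\in\{2,4,6,8,10,12\}$, $\mathrm{Re}(\mathbf{m})$ for $\mathbf{m}\in\mathcal{L}$, and the four products $$\mathrm{Im}(z_4\overline{z}_2^2)\,\mathrm{Im}(z_{12}\overline{z}_6^2),\quad\mathrm{Im}(z_{12}\overline{z}_6^2)\,\mathrm{Im}(z_8\overline{z}_4^2),\quad\mathrm{Im}(z_{12}\overline{z}_{10}\overline{z}_2)\,\mathrm{Im}(z_8\overline{z}_4^2),\quad\mathrm{Im}(z_{12}\overline{z}_6^2)\,\mathrm{Im}(z_{10}\overline{z}_2\overline{z}_8).$$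
   Context: $\mathrm{O}(2)$ is generated by rotations $r_\theta$ and $\sigma=\mathrm{diag}(1,-1)$ and acts on tensors in the standard way. $\mathbb{H}^0=\mathbb{H}^0(\mathbb{R}^2)=\mathbb{R}$ is the trivial representation (coordinate $\lambda$); for $n\ge1$, $\mathbb{H}^n=\mathbb{H}^n(\mathbb{R}^2)$ is the two-dimensional irreducible representation where $r_\theta$ acts as rotation of angle $n\theta$ and $\sigma$ as $\mathrm{diag}(1,-1)$. An explicit harmonic decomposition is a choice of $\mathrm{O}(2)$-equivariant linear isomorphism with the indicated direct sum; a component $(a,b)$ in the factor $\mathbb{H}^n$ is encoded by $z_n=a+ib$, so $r_\theta$ acts by $z_n\mapsto e^{in\theta}z_n$ and $\sigma$ by conjugation. $\mathrm{Inv}(\mathbb{V},G)$ is the algebra of $G$-invariant real polynomials on $\mathbb{V}$. An integrity basis is a finite set of homogeneous generators of the algebra; it is minimal if no proper subset generates. *)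

theory Defs
  imports "HOL-Analysis.Analysis"
begin

section \<open>Invariant polynomials and integrity bases\<close>

text \<open>Polynomials on a subspace \<open>V\<close> of a normed space are polynomial functions with domain \<open>V\<close>.
  They are extensional (undefined outside \<open>V\<close>), so that two of them are equal iff they agree on \<open>V\<close>.\<close>

definition polynomials_on :: "'a::real_normed_vector set \<Rightarrow> ('a \<Rightarrow> real) set"
  where "polynomials_on V = {restrict p V | p. real_polynomial_function p}"

definition Inv :: "'a::real_normed_vector set \<Rightarrow> 'g set \<Rightarrow> ('g \<Rightarrow> 'a \<Rightarrow> 'a) \<Rightarrow> ('a \<Rightarrow> real) set"
  where "Inv V G act = {f \<in> polynomials_on V. \<forall>g\<in>G. \<forall>x\<in>V. f (act g x) = f x}"

inductive_set generated_algebra :: "'a set \<Rightarrow> ('a \<Rightarrow> real) set \<Rightarrow> ('a \<Rightarrow> real) set"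
  for V :: "'a set" and B :: "('a \<Rightarrow> real) set"
where
  const: "restrict (\<lambda>x. c) V \<in> generated_algebra V B"
| gen: "f \<in> B \<Longrightarrow> f \<in> generated_algebra V B"
| add: "f \<in> generated_algebra V B \<Longrightarrow> g \<in> generated_algebra V B \<Longrightarrow>
    restrict (\<lambda>x. f x + g x) V \<in> generated_algebra V B"
| mult: "f \<in> generated_algebra V B \<Longrightarrow> g \<in> generated_algebra V B \<Longrightarrow>
    restrict (\<lambda>x. f x * g x) V \<in> generated_algebra V B"

definition homogeneous_on :: "'a::real_vector set \<Rightarrow> ('a \<Rightarrow> real) \<Rightarrow> bool"
  where "homogeneous_on V f \<longleftrightarrow> (\<exists>d::nat. \<forall>x\<in>V. \<forall>c. f (c *\<^sub>R x) = c ^ d * f x)"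

definition integrity_basis ::
    "'a::real_normed_vector set \<Rightarrow> 'g set \<Rightarrow> ('g \<Rightarrow> 'a \<Rightarrow> 'a) \<Rightarrow> ('a \<Rightarrow> real) set \<Rightarrow> bool"
  where "integrity_basis V G act B \<longleftrightarrow>
    finite B \<and> B \<subseteq> Inv V G act \<and> (\<forall>f\<in>B. homogeneous_on V f) \<and>
    generated_algebra V B = Inv V G act"

definition minimal_integrity_basis ::
    "'a::real_normed_vector set \<Rightarrow> 'g set \<Rightarrow> ('g \<Rightarrow> 'a \<Rightarrow> 'a) \<Rightarrow> ('a \<Rightarrow> real) set \<Rightarrow> bool"
  where "minimal_integrity_basis V G act B \<longleftrightarrow>
    integrity_basis V G act B \<and> (\<forall>B'. B' \<subset> B \<longrightarrow> generated_algebra V B' \<noteq> Inv V G act)"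


section \<open>Symmetric tensors on the plane\<close>

text \<open>A tensor of order \<open>CARD('k)\<close> on \<open>\<real>\<^sup>2\<close> is given by its components with respect to the
  canonical basis, indexed by maps from the tensor slots \<open>'k\<close> to \<open>{1, 2}\<close>.\<close>

type_synonym 'k tensor = "(real, 'k \<Rightarrow> 2) vec"

definition Sym :: "'k::finite tensor set"
  where "Sym = {T. \<forall>p. bij p \<longrightarrow> (\<forall>i. T $ (i \<circ> p) = T $ i)}"

definition tensor_act :: "real^2^2 \<Rightarrow> 'k::finite tensor \<Rightarrow> 'k tensor"
  where "tensor_act g T = (\<chi> i. \<Sum>j\<in>UNIV. (\<Prod>s\<in>UNIV. g $ i s $ j s) * T $ j)"

definition O2 :: "(real^2^2) set"
  where "O2 = {g. orthogonal_matrix g}"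

definition SO2 :: "(real^2^2) set"
  where "SO2 = {g. rotation_matrix g}"

definition rot :: "real \<Rightarrow> real^2^2"
  where "rot \<theta> = vector [vector [cos \<theta>, - sin \<theta>], vector [sin \<theta>, cos \<theta>]]"

definition refl_x :: "real^2^2"
  where "refl_x = vector [vector [1, 0], vector [0, - 1]]"


section \<open>Harmonic decomposition\<close>

text \<open>The representation \<open>\<H>\<^sup>n\<close> on \<open>\<complex>\<close>, for \<open>n \<ge> 1\<close>. Every orthogonal matrix \<open>g\<close> is either
  \<open>rot \<theta>\<close> or \<open>rot \<theta> ** refl_x\<close>, according to its determinant, and in both cases its first column
  is \<open>(cos \<theta>, sin \<theta>)\<close>; the lemmas below give the action of the generators.\<close>

definition harm_act :: "nat \<Rightarrow> real^2^2 \<Rightarrow> complex \<Rightarrow> complex"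
  where "harm_act n g z = Complex (g $ 1 $ 1) (g $ 2 $ 1) ^ n * (if det g = 1 then z else cnj z)"

lemma harm_act_rot: "harm_act n (rot \<theta>) z = cis (n * \<theta>) * z"
proof -
  have "Complex (cos \<theta>) (sin \<theta>) ^ n = cis (n * \<theta>)"
    using Complex.DeMoivre[of \<theta> n] by (simp add: cis.code)
  then show ?thesis
    by (simp add: harm_act_def rot_def det_2 vector_2 flip: power2_eq_square)
qed

lemma harm_act_refl_x: "harm_act n refl_x z = cnj z"
  by (simp add: harm_act_def refl_x_def det_2 vector_2 flip: one_complex.code)

lemma matrix_2_eq_iff:
  "(g :: real^2^2) = h \<longleftrightarrow>
    g$1$1 = h$1$1 \<and> g$1$2 = h$1$2 \<and> g$2$1 = h$2$1 \<and> g$2$2 = h$2$2"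
  by (auto simp: vec_eq_iff forall_2)

lemma O2_cases:
  assumes "g \<in> O2"
  obtains \<theta> where "g = rot \<theta>" | \<theta> where "g = rot \<theta> ** refl_x"
proof -
  define a b c d where abcd: "a = g$1$1" "b = g$1$2" "c = g$2$1" "d = g$2$2"
  have "transpose g ** g = mat 1"
    using assms by (simp add: O2_def orthogonal_matrix_def)
  then have *: "a*a + c*c = 1" "a*b + c*d = 0" "b*b + d*d = 1"
    unfolding matrix_2_eq_iff
    by (simp_all add: matrix_matrix_mult_def transpose_def mat_def sum_2 abcd)
  obtain \<theta> where \<theta>: "a = cos \<theta>" "c = sin \<theta>"
    using sincos_total_2pi[of a c] *(1) by (auto simp: power2_eq_square)
  have "(a*d - b*c)^2 = (a*a + c*c) * (b*b + d*d) - (a*b + c*d)^2"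
    by (simp add: power2_eq_square algebra_simps)
  also have "\<dots> = 1" using * by simp
  finally have "a*d - b*c = 1 \<or> a*d - b*c = -1"
    by (simp add: power2_eq_1_iff)
  moreover have "b = - c * (a*d - b*c)" "d = a * (a*d - b*c)"
    using * by algebra+
  ultimately consider "b = - c" "d = a" | "b = c" "d = - a" by fastforce
  then show thesis
  proof cases
    case 1
    then have "g = rot \<theta>"
      using \<theta> unfolding matrix_2_eq_iff by (simp add: rot_def abcd)
    then show thesis by (rule that(1))
  next
    case 2
    then have "g = rot \<theta> ** refl_x"
      using \<theta> unfolding matrix_2_eq_iff
      by (simp add: rot_def refl_x_def abcd matrix_matrix_mult_def sum_2)
    then show thesis by (rule that(2))
  qed
qed

lemma harm_act_mult:
  assumes "g \<in> O2" "h \<in> O2"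
  shows "harm_act n (g ** h) z = harm_act n g (harm_act n h z)"
proof -
  have *: "det (g ** h) = det g * det h" by (rule det_mul)
  have neg: "- (cos \<theta>)\<^sup>2 - (sin \<theta>)\<^sup>2 \<noteq> 1" for \<theta> :: real
    using sin_cos_squared_add[of \<theta>] by linarith
  have "Complex ((g ** h)$1$1) ((g ** h)$2$1) =
      Complex (g$1$1) (g$2$1) *
        (if det g = 1 then Complex (h$1$1) (h$2$1) else cnj (Complex (h$1$1) (h$2$1)))"
    using assms(1)
    by (cases rule: O2_cases)
      (auto simp: neg matrix_matrix_mult_def sum_2 rot_def refl_x_def det_2 complex_eq_iff
        simp flip: power2_eq_square)
  moreover have "det g = 1 \<or> det g = -1" "det h = 1 \<or> det h = -1"
    using assms by (auto simp: O2_def det_orthogonal_matrix)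
  ultimately show ?thesis
    unfolding harm_act_def by (auto simp: * power_mult_distrib)
qed

text \<open>The direct sum of \<open>\<H>\<^sup>n\<close> for \<open>n = 0, 2, 4, 6, 8, 10, 12\<close>.\<close>

type_synonym harm =
  "real \<times> complex \<times> complex \<times> complex \<times> complex \<times> complex \<times> complex"

fun harm_sum_act :: "real^2^2 \<Rightarrow> harm \<Rightarrow> harm"
  where "harm_sum_act g (l, z2, z4, z6, z8, z10, z12) =
    (l, harm_act 2 g z2, harm_act 4 g z4, harm_act 6 g z6, harm_act 8 g z8,
      harm_act 10 g z10, harm_act 12 g z12)"

definition harmonic_decomposition :: "(12 tensor \<Rightarrow> harm) \<Rightarrow> bool"
  where "harmonic_decomposition \<phi> \<longleftrightarrow>
    (\<forall>S\<in>Sym. \<forall>T\<in>Sym. \<phi> (S + T) = \<phi> S + \<phi> T) \<and>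
    (\<forall>c. \<forall>T\<in>Sym. \<phi> (c *\<^sub>R T) = c *\<^sub>R \<phi> T) \<and>
    bij_betw \<phi> Sym UNIV \<and>
    (\<forall>g\<in>O2. \<forall>T\<in>Sym. \<phi> (tensor_act g T) = harm_sum_act g (\<phi> T))"


section \<open>The generating invariants\<close>

text \<open>Monomials in the coordinates \<open>z k\<close> with \<open>k \<in> {2, 4, 6, 8, 10, 12}\<close> and their conjugates.\<close>

definition monomials :: "((nat \<Rightarrow> complex) \<Rightarrow> complex) list"
  where "monomials = [
   (\<lambda>z. z 4 * cnj (z 2)^2),
   (\<lambda>z. z 8 * cnj (z 4)^2),
   (\<lambda>z. z 12 * cnj (z 6)^2),
   (\<lambda>z. z 12 * cnj (z 10) * cnj (z 2)),
   (\<lambda>z. z 6 * cnj (z 2) * cnj (z 4)),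
   (\<lambda>z. z 8 * cnj (z 2) * cnj (z 6)),
   (\<lambda>z. z 10 * cnj (z 4) * cnj (z 6)),
   (\<lambda>z. z 10 * cnj (z 2) * cnj (z 8)),
   (\<lambda>z. z 12 * cnj (z 4) * cnj (z 8)),
   (\<lambda>z. z 6 * cnj (z 2)^3),
   (\<lambda>z. z 12 * cnj (z 4)^3),
   (\<lambda>z. z 6^2 * cnj (z 10) * cnj (z 2)),
   (\<lambda>z. z 8^2 * cnj (z 12) * cnj (z 4)),
   (\<lambda>z. z 8 * cnj (z 2)^2 * cnj (z 4)),
   (\<lambda>z. z 10 * cnj (z 2) * cnj (z 4)^2),
   (\<lambda>z. z 4^2 * cnj (z 2) * cnj (z 6)),
   (\<lambda>z. z 10 * cnj (z 2)^2 * cnj (z 6)),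
   (\<lambda>z. z 10^2 * cnj (z 12) * cnj (z 8)),
   (\<lambda>z. z 12 * cnj (z 2)^2 * cnj (z 8)),
   (\<lambda>z. z 6^2 * cnj (z 4) * cnj (z 8)),
   (\<lambda>z. z 8^2 * cnj (z 10) * cnj (z 6)),
   (\<lambda>z. z 4 * z 8 * cnj (z 10) * cnj (z 2)),
   (\<lambda>z. z 10 * z 4 * cnj (z 12) * cnj (z 2)),
   (\<lambda>z. z 6 * z 8 * cnj (z 12) * cnj (z 2)),
   (\<lambda>z. z 6 * z 8 * cnj (z 10) * cnj (z 4)),
   (\<lambda>z. z 10 * z 6 * cnj (z 12) * cnj (z 4)),
   (\<lambda>z. z 10 * z 8 * cnj (z 12) * cnj (z 6)),
   (\<lambda>z. z 12 * cnj (z 2) * cnj (z 4) * cnj (z 6)),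
   (\<lambda>z. z 4 * z 6 * cnj (z 2) * cnj (z 8)),
   (\<lambda>z. z 8 * cnj (z 2)^4),
   (\<lambda>z. z 6^2 * cnj (z 4)^3),
   (\<lambda>z. z 12^2 * cnj (z 8)^3),
   (\<lambda>z. z 4^3 * cnj (z 10) * cnj (z 2)),
   (\<lambda>z. z 8^2 * cnj (z 12) * cnj (z 2)^2),
   (\<lambda>z. z 12^2 * cnj (z 10)^2 * cnj (z 4)),
   (\<lambda>z. z 10 * cnj (z 2)^3 * cnj (z 4)),
   (\<lambda>z. z 10^2 * cnj (z 12) * cnj (z 4)^2),
   (\<lambda>z. z 12 * cnj (z 2)^2 * cnj (z 4)^2),
   (\<lambda>z. z 12 * cnj (z 2)^3 * cnj (z 6)),
   (\<lambda>z. z 10 * z 8 * cnj (z 6)^3),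
   (\<lambda>z. z 6^2 * cnj (z 2)^2 * cnj (z 8)),
   (\<lambda>z. z 10^2 * cnj (z 6)^2 * cnj (z 8)),
   (\<lambda>z. z 10^2 * cnj (z 4) * cnj (z 8)^2),
   (\<lambda>z. z 8^2 * cnj (z 4) * cnj (z 6)^2),
   (\<lambda>z. z 4^2 * z 6 * cnj (z 12) * cnj (z 2)),
   (\<lambda>z. z 6 * z 8 * cnj (z 10) * cnj (z 2)^2),
   (\<lambda>z. z 10 * z 6 * cnj (z 12) * cnj (z 2)^2),
   (\<lambda>z. z 8^2 * cnj (z 10) * cnj (z 2) * cnj (z 4)),
   (\<lambda>z. z 12 * z 6 * cnj (z 10) * cnj (z 4)^2),
   (\<lambda>z. z 10^2 * cnj (z 12) * cnj (z 2) * cnj (z 6)),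
   (\<lambda>z. z 10 * z 4 * cnj (z 2) * cnj (z 6)^2),
   (\<lambda>z. z 10 * z 6 * cnj (z 4)^2 * cnj (z 8)),
   (\<lambda>z. z 12^2 * cnj (z 10) * cnj (z 6) * cnj (z 8)),
   (\<lambda>z. z 12 * z 6 * cnj (z 2) * cnj (z 8)^2),
   (\<lambda>z. z 10 * z 12 * cnj (z 6) * cnj (z 8)^2),
   (\<lambda>z. z 10 * z 8 * cnj (z 12) * cnj (z 2) * cnj (z 4)),
   (\<lambda>z. z 12 * z 8 * cnj (z 10) * cnj (z 4) * cnj (z 6)),
   (\<lambda>z. z 12 * z 4 * cnj (z 2) * cnj (z 6) * cnj (z 8)),
   (\<lambda>z. z 10 * cnj (z 2)^5),
   (\<lambda>z. z 8^2 * cnj (z 10) * cnj (z 2)^3),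
   (\<lambda>z. z 8^3 * cnj (z 10)^2 * cnj (z 4)),
   (\<lambda>z. z 12 * cnj (z 2)^4 * cnj (z 4)),
   (\<lambda>z. z 10^3 * cnj (z 12)^2 * cnj (z 6)),
   (\<lambda>z. z 6^3 * cnj (z 10) * cnj (z 4)^2),
   (\<lambda>z. z 8^3 * cnj (z 12) * cnj (z 6)^2),
   (\<lambda>z. z 10^2 * cnj (z 2) * cnj (z 6)^3),
   (\<lambda>z. z 10^2 * cnj (z 4)^3 * cnj (z 8)),
   (\<lambda>z. z 6^3 * cnj (z 2) * cnj (z 8)^2),
   (\<lambda>z. z 10 * z 6 * cnj (z 4)^4),
   (\<lambda>z. z 6 * z 8^2 * cnj (z 10)^2 * cnj (z 2)),
   (\<lambda>z. z 8^3 * cnj (z 10) * cnj (z 12) * cnj (z 2)),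
   (\<lambda>z. z 10^2 * z 6 * cnj (z 12)^2 * cnj (z 2)),
   (\<lambda>z. z 10 * z 8 * cnj (z 12) * cnj (z 2)^3),
   (\<lambda>z. z 10 * z 8^2 * cnj (z 12)^2 * cnj (z 2)),
   (\<lambda>z. z 12 * z 6^2 * cnj (z 10)^2 * cnj (z 4)),
   (\<lambda>z. z 10^2 * z 8 * cnj (z 12)^2 * cnj (z 4)),
   (\<lambda>z. z 10^2 * cnj (z 12) * cnj (z 2)^2 * cnj (z 4)),
   (\<lambda>z. z 12^2 * cnj (z 10) * cnj (z 4)^2 * cnj (z 6)),
   (\<lambda>z. z 12^2 * cnj (z 2) * cnj (z 6) * cnj (z 8)^2),
   (\<lambda>z. z 12 * cnj (z 2)^6),
   (\<lambda>z. z 8^3 * cnj (z 6)^4),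
   (\<lambda>z. z 10^2 * cnj (z 4)^5),
   (\<lambda>z. z 10^2 * cnj (z 12) * cnj (z 2)^4),
   (\<lambda>z. z 6^4 * cnj (z 10)^2 * cnj (z 4)),
   (\<lambda>z. z 12^3 * cnj (z 10)^3 * cnj (z 6)),
   (\<lambda>z. z 10^3 * cnj (z 12) * cnj (z 6)^3),
   (\<lambda>z. z 12^3 * cnj (z 10)^2 * cnj (z 8)^2),
   (\<lambda>z. z 10^3 * cnj (z 6) * cnj (z 8)^3),
   (\<lambda>z. z 10^2 * z 12 * cnj (z 8)^4),
   (\<lambda>z. z 8^3 * cnj (z 10)^2 * cnj (z 2)^2),
   (\<lambda>z. z 10^2 * z 8 * cnj (z 12)^2 * cnj (z 2)^2),
   (\<lambda>z. z 10^3 * cnj (z 12)^2 * cnj (z 2) * cnj (z 4)),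
   (\<lambda>z. z 10^3 * cnj (z 6)^5),
   (\<lambda>z. z 8^4 * cnj (z 10)^3 * cnj (z 2)),
   (\<lambda>z. z 10^4 * cnj (z 12)^3 * cnj (z 4)),
   (\<lambda>z. z 10^3 * cnj (z 12)^2 * cnj (z 2)^3),
   (\<lambda>z. z 10^3 * z 8 * cnj (z 12)^3 * cnj (z 2)),
   (\<lambda>z. z 10^4 * cnj (z 8)^5),
   (\<lambda>z. z 10^4 * cnj (z 12)^3 * cnj (z 2)^2),
   (\<lambda>z. z 12^4 * cnj (z 10)^4 * cnj (z 8)),
   (\<lambda>z. z 10^5 * cnj (z 12)^4 * cnj (z 2)),
   (\<lambda>z. z 12^5 * cnj (z 10)^6)
  ]"

lemma length_monomials: "length monomials = 102"
  by (simp add: monomials_def)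

text \<open>In the following sets, \<open>l T\<close> and \<open>z k T\<close> are the coordinates of the tensor \<open>T\<close>.
  The number \<open>z k T * cnj (z k T)\<close> is real.\<close>

definition common_invariants ::
    "('a \<Rightarrow> real) \<Rightarrow> (nat \<Rightarrow> 'a \<Rightarrow> complex) \<Rightarrow> ('a \<Rightarrow> real) set"
  where "common_invariants l z =
    {l} \<union> {\<lambda>T. Re (z k T * cnj (z k T)) | k. k \<in> {2, 4, 6, 8, 10, 12}} \<union>
    {\<lambda>T. Re (m (\<lambda>k. z k T)) | m. m \<in> set monomials}"

definition SO2_invariants ::
    "('a \<Rightarrow> real) \<Rightarrow> (nat \<Rightarrow> 'a \<Rightarrow> complex) \<Rightarrow> ('a \<Rightarrow> real) set"
  where "SO2_invariants l z =
    common_invariants l z \<union> {\<lambda>T. Im (m (\<lambda>k. z k T)) | m. m \<in> set monomials}"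

definition O2_invariants ::
    "('a \<Rightarrow> real) \<Rightarrow> (nat \<Rightarrow> 'a \<Rightarrow> complex) \<Rightarrow> ('a \<Rightarrow> real) set"
  where "O2_invariants l z =
    common_invariants l z \<union>
    {\<lambda>T. Im (z 4 T * cnj (z 2 T)^2) * Im (z 12 T * cnj (z 6 T)^2),
     \<lambda>T. Im (z 12 T * cnj (z 6 T)^2) * Im (z 8 T * cnj (z 4 T)^2),
     \<lambda>T. Im (z 12 T * cnj (z 10 T) * cnj (z 2 T)) * Im (z 8 T * cnj (z 4 T)^2),
     \<lambda>T. Im (z 12 T * cnj (z 6 T)^2) * Im (z 10 T * cnj (z 2 T) * cnj (z 8 T))}"

definition restrict_all :: "('a \<Rightarrow> real) set \<Rightarrow> 'a set \<Rightarrow> ('a \<Rightarrow> real) set"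
  where "restrict_all F V = (\<lambda>f. restrict f V) ` F"

end

theory Submission
  imports Defs "HOL-Library.Multiset"
begin

text \<open>Write \<open>k\<close> for the letter \<open>z (2 * k)\<close>, \<open>- k\<close> for its conjugate (\<open>1 \<le> k \<le> 6\<close>) and \<open>0\<close> for the
real coordinate \<open>\<lambda>\<close>. A monomial is then a multiset of integers in \<open>{-6..6}\<close>, conjugation is the
negation \<open>neg\<close> of all letters, and a rotation by \<open>\<theta>\<close> multiplies the monomial \<open>M\<close> by the character
\<open>cis (2 * sum_mset M * \<theta>)\<close>. So the rotation invariants are spanned by the monomials of sum zero,
the \<open>balanced\<close> multisets, and the reflection exchanges \<open>M\<close> and \<open>neg M\<close>.

Generators. The balanced multisets form a monoid whose indecomposable elements, the \<open>atoms\<close>, are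
\<open>{#0#}\<close>, the six \<open>{#k, - k#}\<close>, and the 102 listed monomials together with their conjugates. That
every nonempty balanced multiset contains one of them is a finite search (\<open>contains_atom\<close>): draw
letters one by one, a positive one when the sum drawn so far is negative and a negative one when
it is positive; the partial sums stay bounded, and every such walk soon contains an atom.
Splitting off atoms shows that real and imaginary parts of the atoms generate the \<open>SO(2)\<close>
invariants.

For \<open>O(2)\<close> only the real parts \<open>R M\<close> are needed. The identity \<open>R (A + N) + R (neg A + N) = 2 * R A
* R N\<close> says that, modulo products of invariants of lower degree, negating a factor of a
decomposable monomial only changes the sign of its real part. With three factors this kills the
monomial, because the three negations give contradictory signs. A sum \<open>A + B\<close> of two atoms is
killed as soon as it has a splitting into two parts that share a letter, or one containing a
letter and one its opposite: after a negation a factor \<open>{#k, - k#}\<close>, which is real, splits off. A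
second finite check (\<open>mixed_pair_cases\<close>) shows that all pairs of atoms are of this kind except, up
to conjugation, four; these give the four products of imaginary parts in the theorem
(\<open>O2_monomials_generated\<close>).

Minimality. Distinct monomials are distinct characters of the multiplicative monoid of points,
hence linearly independent (\<open>monomials_independent\<close>), so every polynomial has well-defined
coefficients. As an atom \<open>A\<close> only splits trivially, the coefficient of \<open>A\<close> in a product \<open>p * q\<close> of
invariants is \<open>p\<^sub>0 * q\<^sub>A + p\<^sub>A * q\<^sub>0\<close>. Hence the invariants with a purely imaginary (or real)
coefficient at \<open>A\<close> form a subalgebra; it contains all generators except the real (or imaginary)
part of \<open>A\<close>, which is therefore indispensable. For an exceptional pair \<open>A, B\<close> the only splittings
of \<open>A + B\<close> and of \<open>A + neg B\<close> are the evident ones, and so the conjugation-symmetric invariants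
with equal coefficients at \<open>A + B\<close> and \<open>A + neg B\<close> form a subalgebra. The product \<open>Im A * Im B\<close> is
the only generator outside. Each generator thus lies outside an algebra that contains all others,
which gives minimality and, at the same time, that the generators are pairwise different.\<close>

section \<open>Monomials as multisets of letters\<close>

text \<open>A code \<open>(ps, ns)\<close> of positive integers stands for the monomial with the letters \<open>ps\<close> and the
conjugates of the letters \<open>ns\<close>. The list below follows the order of \<open>monomials\<close>; the entries are
sorted decreasingly, so that a monomial has only one code.\<close>

type_synonym code = "int list \<times> int list"

definition mixed_codes :: "code list" where
  "mixed_codes = [
    ([2],[1,1]), ([4],[2,2]), ([6],[3,3]), ([6],[5,1]), ([3],[2,1]), ([4],[3,1]), ([5],[3,2]),
    ([5],[4,1]), ([6],[4,2]), ([3],[1,1,1]), ([6],[2,2,2]), ([3,3],[5,1]), ([4,4],[6,2]),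
    ([4],[2,1,1]), ([5],[2,2,1]), ([2,2],[3,1]), ([5],[3,1,1]), ([5,5],[6,4]), ([6],[4,1,1]),
    ([3,3],[4,2]), ([4,4],[5,3]), ([4,2],[5,1]), ([5,2],[6,1]), ([4,3],[6,1]), ([4,3],[5,2]),
    ([5,3],[6,2]), ([5,4],[6,3]), ([6],[3,2,1]), ([3,2],[4,1]), ([4],[1,1,1,1]), ([3,3],[2,2,2]),
    ([6,6],[4,4,4]), ([2,2,2],[5,1]), ([4,4],[6,1,1]), ([6,6],[5,5,2]), ([5],[2,1,1,1]),
    ([5,5],[6,2,2]), ([6],[2,2,1,1]), ([6],[3,1,1,1]), ([5,4],[3,3,3]), ([3,3],[4,1,1]),
    ([5,5],[4,3,3]), ([5,5],[4,4,2]), ([4,4],[3,3,2]), ([3,2,2],[6,1]), ([4,3],[5,1,1]),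
    ([5,3],[6,1,1]), ([4,4],[5,2,1]), ([6,3],[5,2,2]), ([5,5],[6,3,1]), ([5,2],[3,3,1]),
    ([5,3],[4,2,2]), ([6,6],[5,4,3]), ([6,3],[4,4,1]), ([6,5],[4,4,3]), ([5,4],[6,2,1]),
    ([6,4],[5,3,2]), ([6,2],[4,3,1]), ([5],[1,1,1,1,1]), ([4,4],[5,1,1,1]), ([4,4,4],[5,5,2]),
    ([6],[2,1,1,1,1]), ([5,5,5],[6,6,3]), ([3,3,3],[5,2,2]), ([4,4,4],[6,3,3]),
    ([5,5],[3,3,3,1]), ([5,5],[4,2,2,2]), ([3,3,3],[4,4,1]), ([5,3],[2,2,2,2]),
    ([4,4,3],[5,5,1]), ([4,4,4],[6,5,1]), ([5,5,3],[6,6,1]), ([5,4],[6,1,1,1]),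
    ([5,4,4],[6,6,1]), ([6,3,3],[5,5,2]), ([5,5,4],[6,6,2]), ([5,5],[6,2,1,1]),
    ([6,6],[5,3,2,2]), ([6,6],[4,4,3,1]), ([6],[1,1,1,1,1,1]), ([4,4,4],[3,3,3,3]),
    ([5,5],[2,2,2,2,2]), ([5,5],[6,1,1,1,1]), ([3,3,3,3],[5,5,2]), ([6,6,6],[5,5,5,3]),
    ([5,5,5],[6,3,3,3]), ([6,6,6],[5,5,4,4]), ([5,5,5],[4,4,4,3]), ([6,5,5],[4,4,4,4]),
    ([4,4,4],[5,5,1,1]), ([5,5,4],[6,6,1,1]), ([5,5,5],[6,6,2,1]), ([5,5,5],[3,3,3,3,3]),
    ([4,4,4,4],[5,5,5,1]), ([5,5,5,5],[6,6,6,2]), ([5,5,5],[6,6,1,1,1]), ([5,5,5,4],[6,6,6,1]),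
    ([5,5,5,5],[4,4,4,4,4]), ([5,5,5,5],[6,6,6,1,1]), ([6,6,6,6],[5,5,5,5,4]),
    ([5,5,5,5,5],[6,6,6,6,1]), ([6,6,6,6,6],[5,5,5,5,5,5])
  ]"

definition atom_codes :: "code list" where
  "atom_codes = map (\<lambda>k. ([k], [k])) [1..6] @ mixed_codes @ map prod.swap mixed_codes"

definition neg :: "int multiset \<Rightarrow> int multiset"
  where "neg M = image_mset uminus M"

definition word :: "code \<Rightarrow> int multiset"
  where "word c = mset (fst c) + neg (mset (snd c))"

definition balanced :: "int multiset \<Rightarrow> bool"
  where "balanced M \<longleftrightarrow> set_mset M \<subseteq> {-6..6} \<and> sum_mset M = 0"

text \<open>The letter \<open>0\<close> is kept out of the codes, whose letters are positive; it contributes one more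
atom.\<close>

definition atoms :: "int multiset set"
  where "atoms = insert {#0#} (word ` set atom_codes)"

lemma neg_simps [simp]:
  "neg {#} = {#}" "neg (M + N) = neg M + neg N" "neg (neg M) = M"
      "neg (add_mset x M) = add_mset (- x) (neg M)"
  "neg M = {#} \<longleftrightarrow> M = {#}" "size (neg M) = size M" "sum_mset (neg M) = - sum_mset M"
  "set_mset (neg M) = uminus ` set_mset M"
  by (simp_all add: neg_def multiset.map_comp sum_mset.neutral comp_def)
     (induction M; simp)

lemma balanced_neg [simp]: "balanced (neg M) \<longleftrightarrow> balanced M"
proof -
  have "uminus ` S \<subseteq> {-6..6} \<longleftrightarrow> S \<subseteq> {-6..6}" for S :: "int set" by force
  then show ?thesis by (auto simp: balanced_def)
qed

lemma balanced_add: "balanced M \<Longrightarrow> balanced N \<Longrightarrow> balanced (M + N)"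
  by (auto simp: balanced_def)

lemma balanced_diff: "balanced M \<Longrightarrow> balanced N \<Longrightarrow> N \<subseteq># M \<Longrightarrow> balanced (M - N)"
  by (auto simp: balanced_def sum_mset_diff dest: in_diffD)

lemma neg_mono: "M \<subseteq># N \<Longrightarrow> neg M \<subseteq># neg N"
  by (simp add: neg_def image_mset_subseteq_mono)

lemma word_swap: "word (prod.swap c) = neg (word c)"
  by (simp add: word_def)

section \<open>Every balanced multiset contains an atom\<close>

text \<open>The search keeps a list of candidates: for each atom that may still be found, the code of
those of its letters that have not been drawn yet. The letters of each sign are drawn in weakly
decreasing order. Hence, when \<open>p\<close> is drawn as a positive letter, a candidate waiting for a letter
larger than \<open>p\<close> can be discarded.\<close>

fun advance :: "int \<Rightarrow> code list \<Rightarrow> code list" where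
  "advance p [] = []"
| "advance p (([], ns) # cs) = ([], ns) # advance p cs"
| "advance p ((x # ps, ns) # cs) =
    (if x = p then (ps, ns) # advance p cs
     else if x < p then (x # ps, ns) # advance p cs
     else advance p cs)"

fun advance_neg :: "int \<Rightarrow> code list \<Rightarrow> code list" where
  "advance_neg q [] = []"
| "advance_neg q ((ps, []) # cs) = (ps, []) # advance_neg q cs"
| "advance_neg q ((ps, x # ns) # cs) =
    (if x = q then (ps, ns) # advance_neg q cs
     else if x < q then (ps, x # ns) # advance_neg q cs
     else advance_neg q cs)"

fun finished :: "code list \<Rightarrow> bool" where
  "finished [] = False"
| "finished (c # cs) = (case c of ([], []) \<Rightarrow> True | _ \<Rightarrow> finished cs)"

text \<open>Here \<open>s\<close> is the sum of the letters drawn so far, \<open>h\<close> and \<open>k\<close> bound the positive and negative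
letters still to come, and \<open>n\<close> bounds their number. A sum \<open>s = 0\<close> without a complete atom is a
failure, since there the multiset may be exhausted.\<close>

fun covers :: "nat \<Rightarrow> int \<Rightarrow> int \<Rightarrow> int \<Rightarrow> code list \<Rightarrow> bool" where
  "covers 0 s h k cs = False"
| "covers (Suc n) s h k cs =
    (if finished cs then True
     else if s < 0 then list_all (\<lambda>p. covers n (s + p) p k (advance p cs)) [1..h]
     else if s > 0 then list_all (\<lambda>q. covers n (s - q) h q (advance_neg q cs)) [1..k]
     else False)"

text \<open>A nonempty balanced multiset without the letter \<open>0\<close> has positive letters, and the walk
starts with the largest one. Eleven is the largest degree of a listed monomial.\<close>

definition walks_covered where
  "walks_covered p \<longleftrightarrow> covers 11 p p 6 (advance p atom_codes)"

lemma walks_covered_1: "walks_covered 1"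
  by code_simp

lemma walks_covered_2: "walks_covered 2"
  by code_simp

lemma walks_covered_3: "walks_covered 3"
  by code_simp

lemma walks_covered_4: "walks_covered 4"
  by code_simp

lemma walks_covered_5: "walks_covered 5"
  by code_simp

lemma walks_covered_6: "walks_covered 6"
  by code_simp

lemmas walks_covered_all = walks_covered_1 walks_covered_2 walks_covered_3 walks_covered_4
  walks_covered_5 walks_covered_6

lemma advance_sound:
  assumes "d \<in> set (advance p cs)"
  shows "\<exists>c\<in>set cs. word c \<subseteq># {#p#} + word d"
  using assms
proof (induction p cs rule: advance.induct)
  case (3 p x ps ns cs)
  then show ?case by (fastforce simp: word_def split: if_splits)
qed (auto simp: word_def)

lemma advance_neg_sound:
  assumes "d \<in> set (advance_neg q cs)"
  shows "\<exists>c\<in>set cs. word c \<subseteq># {#- q#} + word d"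
  using assms
proof (induction q cs rule: advance_neg.induct)
  case (3 q ps x ns cs)
  then show ?case by (fastforce simp: word_def split: if_splits)
qed (auto simp: word_def)

lemma finished_iff: "finished cs \<longleftrightarrow> ([], []) \<in> set cs"
  by (induction cs) (auto split: prod.splits list.splits)

text \<open>The next letter of a walk exists because the remaining letters cancel the sum drawn so far.\<close>

lemma positive_letter:
  fixes R :: "int multiset"
  assumes "0 < sum_mset R \<or> sum_mset R = 0 \<and> R \<noteq> {#} \<and> 0 \<notin># R"
  shows "\<exists>x\<in>#R. 0 < x"
proof (rule ccontr)
  assume *: "\<not> (\<exists>x\<in>#R. 0 < x)"
  then have "sum_mset R \<le> 0"
    by (induction R) (auto simp: not_less intro: add_nonpos_nonpos)
  moreover have "sum_mset R < 0" if "R \<noteq> {#}" "0 \<notin># R"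
    using that *
  proof (induction R)
    case (add x R)
    then show ?case by (cases "R = {#}") (auto simp: not_less intro: add_neg_neg)
  qed simp
  ultimately show False using assms by auto
qed

lemma largest_letter:
  fixes R :: "int multiset"
  assumes "\<exists>x\<in>#R. 0 < x" "set_mset R \<subseteq> {-k..h}"
  obtains p R' where "R = add_mset p R'" "1 \<le> p" "p \<le> h" "set_mset R' \<subseteq> {-k..p}"
proof -
  define p where "p = Max (set_mset R)"
  obtain x where x: "x \<in># R" "0 < x" using assms(1) by blast
  have p: "p \<in># R" using x unfolding p_def by (intro Max_in) auto
  have le: "y \<le> p" if "y \<in># R" for y using that unfolding p_def by (intro Max_ge) auto
  obtain R' where R': "R = add_mset p R'" using p by (metis multi_member_split)
  have "set_mset R' \<subseteq> {-k..p}"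
  proof
    fix y assume "y \<in># R'"
    then have "y \<in># R" by (simp add: R')
    then show "y \<in> {-k..p}" using assms(2) le[of y] by auto
  qed
  moreover have "1 \<le> p" "p \<le> h" using le[OF x(1)] x(2) p assms(2) by auto
  ultimately show thesis using that R' by blast
qed

text \<open>The multiset is split into the letters \<open>W\<close> drawn so far and the remaining letters \<open>R\<close>. The
invariant of the search is that each candidate, together with \<open>W\<close>, contains an atom; a candidate
without outstanding letters is therefore an atom inside \<open>W\<close>.\<close>

lemma covers_sound:
  assumes "covers n s h k cs" and "sum_mset R = - s" "set_mset R \<subseteq> {-k..h}"
    and "\<And>c. c \<in> set cs \<Longrightarrow> \<exists>A\<in>atoms. A \<subseteq># W + word c"
  shows "\<exists>A\<in>atoms. A \<subseteq># W + R"
  using assms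
proof (induction n arbitrary: s h k cs W R)
  case (Suc n)
  consider "finished cs" | "\<not> finished cs" "s < 0" | "\<not> finished cs" "s > 0"
    using Suc.prems(1) by (auto split: if_splits)
  then show ?case
  proof cases
    case 1
    then obtain A where "A \<in> atoms" "A \<subseteq># W"
      using Suc.prems(4)[of "([], [])"] by (auto simp: finished_iff word_def)
    then show ?thesis by (meson mset_subset_eq_add_left subset_mset.order_trans)
  next
    case 2
    then have "\<exists>x\<in>#R. 0 < x" using Suc.prems(2) by (intro positive_letter) simp
    then obtain p R' where R: "R = add_mset p R'" and p: "1 \<le> p" "p \<le> h"
        and R': "set_mset R' \<subseteq> {-k..p}"
      using Suc.prems(3) by (rule largest_letter)
    have "\<exists>A\<in>atoms. A \<subseteq># ({#p#} + W) + R'"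
    proof (rule Suc.IH)
      show "covers n (s + p) p k (advance p cs)"
        using Suc.prems(1) 2 p by (auto simp: list_all_iff)
      show "sum_mset R' = - (s + p)" using Suc.prems(2) by (simp add: R)
      fix d assume "d \<in> set (advance p cs)"
      then obtain c where "c \<in> set cs" "word c \<subseteq># {#p#} + word d" using advance_sound by blast
      moreover then obtain A where "A \<in> atoms" "A \<subseteq># W + word c" using Suc.prems(4) by blast
      ultimately have "A \<subseteq># W + ({#p#} + word d)"
        by (meson mset_subset_eq_mono_add_left_cancel subset_mset.order_trans)
      then show "\<exists>A\<in>atoms. A \<subseteq># {#p#} + W + word d"
        using \<open>A \<in> atoms\<close> by (auto simp: ac_simps)
    qed (use R' in auto)
    then show ?thesis by (simp add: R)
  next
    case 3
    then have "\<exists>x\<in>#neg R. 0 < x" using Suc.prems(2) by (intro positive_letter) simp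
    moreover have "set_mset (neg R) \<subseteq> {-h..k}" using Suc.prems(3) by auto
    ultimately obtain q R' where R: "neg R = add_mset q R'" and q: "1 \<le> q" "q \<le> k"
        and R': "set_mset R' \<subseteq> {-h..q}"
      by (rule largest_letter)
    have "R = neg (neg R)" by simp
    then have R: "R = add_mset (- q) (neg R')" by (simp only: R neg_simps)
    have "\<exists>A\<in>atoms. A \<subseteq># ({#- q#} + W) + neg R'"
    proof (rule Suc.IH)
      show "covers n (s - q) h q (advance_neg q cs)"
        using Suc.prems(1) 3 q by (auto simp: list_all_iff)
      show "sum_mset (neg R') = - (s - q)" using Suc.prems(2) by (simp add: R)
      fix d assume "d \<in> set (advance_neg q cs)"
      then obtain c where "c \<in> set cs" "word c \<subseteq># {#- q#} + word d" using advance_neg_sound by blast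
      moreover then obtain A where "A \<in> atoms" "A \<subseteq># W + word c" using Suc.prems(4) by blast
      ultimately have "A \<subseteq># W + ({#- q#} + word d)"
        by (meson mset_subset_eq_mono_add_left_cancel subset_mset.order_trans)
      then show "\<exists>A\<in>atoms. A \<subseteq># {#- q#} + W + word d"
        using \<open>A \<in> atoms\<close> by (auto simp: ac_simps)
    qed (use R' in auto)
    then show ?thesis by (simp add: R)
  qed
qed simp

theorem contains_atom:
  assumes "balanced M" "M \<noteq> {#}"
  shows "\<exists>A\<in>atoms. A \<subseteq># M"
proof (cases "0 \<in># M")
  case True
  then show ?thesis by (intro bexI[of _ "{#0#}"]) (auto simp: atoms_def)
next
  case False
  then have "\<exists>x\<in>#M. 0 < x" using assms by (intro positive_letter) (simp add: balanced_def)
  moreover have "set_mset M \<subseteq> {-6..6}" using assms(1) by (simp add: balanced_def)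
  ultimately obtain p R where M: "M = add_mset p R" and p: "1 \<le> p" "p \<le> 6"
      and R: "set_mset R \<subseteq> {-6..p}"
    by (rule largest_letter)
  have "\<exists>A\<in>atoms. A \<subseteq># {#p#} + R"
  proof (rule covers_sound)
    have "p \<in> {1, 2, 3, 4, 5, 6}" using p by auto
    then show "covers 11 p p 6 (advance p atom_codes)"
      using walks_covered_all by (auto simp: walks_covered_def)
    show "sum_mset R = - p" using assms(1) by (simp add: M balanced_def)
    fix d assume "d \<in> set (advance p atom_codes)"
    then show "\<exists>A\<in>atoms. A \<subseteq># {#p#} + word d"
      using advance_sound by (fastforce simp: atoms_def)
  qed (use R in simp)
  then show ?thesis by (simp add: M)
qed

section \<open>Indecomposability of atoms and sums of two atoms\<close>

definition well_formed :: "code \<Rightarrow> bool" where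
  "well_formed c \<longleftrightarrow> list_all (\<lambda>x. 0 < x \<and> x \<le> 6) (fst c) \<and> list_all (\<lambda>x. 0 < x \<and> x \<le> 6) (snd c) \<and>
   sum_list (fst c) = sum_list (snd c) \<and>
   sorted_wrt (\<ge>) (fst c) \<and> sorted_wrt (\<ge>) (snd c)"

definition pair_codes :: "code list"
  where "pair_codes = map (\<lambda>k. ([k], [k])) [1..6]"

text \<open>Removing duplicates keeps these lists as short as the range of the sums, whereas the number
of subsets grows exponentially.\<close>

definition subset_sums :: "int list \<Rightarrow> int list" where
  "subset_sums xs = foldr (\<lambda>x S. remdups (S @ map ((+) x) S)) xs [0]"

text \<open>A balanced part of the monomial has equal positive and negative sums. If the only sums that
are common to subsets of the two sides are \<open>0\<close> and the total, the part is empty or everything,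
because the letters of a code are positive.\<close>

definition indecomposable :: "code \<Rightarrow> bool" where
  "indecomposable c \<longleftrightarrow>
    list_all (\<lambda>s. s = 0 \<or> s = sum_list (fst c) \<or> \<not> List.member (subset_sums (snd c)) s)
      (subset_sums (fst c))"

fun take_out :: "int list \<Rightarrow> int list \<Rightarrow> int list option" where
  "take_out [] ys = Some ys"
| "take_out (x # xs) ys = (if List.member ys x then take_out xs (remove1 x ys) else None)"

definition remainder :: "code \<Rightarrow> code \<Rightarrow> code option" where
  "remainder c d =
    (case take_out (fst c) (fst d) of None \<Rightarrow> None
     | Some us \<Rightarrow> map_option (Pair us) (take_out (snd c) (snd d)))"

definition share_letter :: "code \<Rightarrow> code \<Rightarrow> bool" where
  "share_letter c d \<longleftrightarrow> list_ex (List.member (fst d)) (fst c) \<or> list_ex (List.member (snd d)) (snd c)"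

definition merge :: "code \<Rightarrow> code \<Rightarrow> code" where
  "merge a b = (fst a @ fst b, snd a @ snd b)"

text \<open>The factors of the four products of imaginary parts.\<close>

definition exceptional_pairs :: "(code \<times> code) list" where
  "exceptional_pairs =
    [(([2], [1, 1]), ([6], [3, 3])), (([6], [3, 3]), ([4], [2, 2])),
     (([6], [5, 1]), ([4], [2, 2])), (([6], [3, 3]), ([5], [4, 1]))]"

text \<open>The sum of two atoms is harmless if a letter or its opposite occurs in both, or if some atom
\<open>c\<close> inside the sum shares a letter with its complement: negating one of the two parts then creates
a pair of opposite letters.\<close>

definition flippable :: "code \<Rightarrow> code \<Rightarrow> bool" where
  "flippable a b \<longleftrightarrow> share_letter a b \<or> share_letter a (prod.swap b)
    \<or> list_ex (\<lambda>c. case remainder c (merge a b) of None \<Rightarrow> False | Some d \<Rightarrow> share_letter c d)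
        atom_codes
    \<or> List.member exceptional_pairs (a, b) \<or> List.member exceptional_pairs (b, a)"

text \<open>If \<open>a\<close> and \<open>b\<close> are the only atoms inside \<open>a + b\<close>, this sum has no other splitting into
balanced parts.\<close>

definition splits_only_as :: "code \<Rightarrow> code \<Rightarrow> bool" where
  "splits_only_as a b \<longleftrightarrow> list_all (\<lambda>c. remainder c (merge a b) = None \<or> c = a \<or> c = b) atom_codes"

lemma well_formed_codes: "list_all well_formed (pair_codes @ mixed_codes)"
  by code_simp

lemma indecomposable_codes: "list_all indecomposable (pair_codes @ mixed_codes)"
  by code_simp

lemma distinct_codes: "distinct (mixed_codes @ map prod.swap mixed_codes)"
  by code_simp

lemma flippable_codes: "sorted_wrt flippable mixed_codes"
  by code_simp

text \<open>Replacing \<open>b\<close> by its swap treats the sum of one atom and the conjugate of the other.\<close>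

lemma exceptional_codes: "list_all (\<lambda>(a, b). List.member mixed_codes a \<and> List.member mixed_codes b \<and>
    splits_only_as a b \<and> splits_only_as a (prod.swap b)) exceptional_pairs" by code_simp

lemma atom_codes_eq:
    "set atom_codes = set pair_codes \<union> set mixed_codes \<union> prod.swap ` set mixed_codes"
  by (auto simp: atom_codes_def pair_codes_def)

lemma split_subset_mset: assumes "U \<subseteq># A + B" obtains X Y where "U = X + Y" "X \<subseteq># A" "Y \<subseteq># B"
proof
  show "U = (U \<inter># A) + (U - A)" by (auto simp: multiset_eq_iff min_def)
  show "U - A \<subseteq># B" using assms by (simp add: subset_eq_diff_conv add.commute)
qed simp

lemma sum_in_subset_sums: "X \<subseteq># mset xs \<Longrightarrow> sum_mset X \<in> set (subset_sums xs)"
proof (induction xs arbitrary: X)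
  case (Cons x xs)
  show ?case
  proof (cases "x \<in># X")
    case True
    then obtain Y where X: "X = add_mset x Y" by (meson multi_member_split)
    then have "sum_mset Y \<in> set (subset_sums xs)" using Cons by simp
    then show ?thesis by (auto simp: X subset_sums_def)
  next
    case False
    then have "X \<subseteq># mset xs" using Cons.prems
        by (metis mset.simps(2) diff_single_trivial subset_eq_diff_conv add_mset_add_single)
    then show ?thesis using Cons.IH by (auto simp: subset_sums_def)
  qed
qed (simp add: subset_sums_def)

lemma positive_sum_zero:
  fixes P :: "int multiset"
  assumes "\<forall>x\<in>#P. 0 < x" "sum_mset P = 0"
  shows "P = {#}"
  using assms
proof (induction P)
  case (add x P)
  have "0 < x" "\<forall>x\<in>#P. 0 < x" using add.prems(1) by simp_all
  moreover from this(2) have "0 \<le> sum_mset P" by (induction P) auto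
  ultimately show ?case using add.prems(2) by simp
qed simp

lemma well_formed_letters: assumes "well_formed c"
  shows "\<forall>x\<in>set (fst c). 0 < x \<and> x \<le> 6" "\<forall>x\<in>set (snd c). 0 < x \<and> x \<le> 6"
  using assms by (auto simp: well_formed_def list_all_iff)

lemma indecomposable_word:
  assumes "well_formed c" "indecomposable c" "U \<subseteq># word c" "sum_mset U = 0"
  shows "U = {#} \<or> U = word c"
proof -
  obtain P Y where U: "U = P + Y" and P: "P \<subseteq># mset (fst c)" and "Y \<subseteq># neg (mset (snd c))"
    using assms(3) by (auto simp: word_def elim: split_subset_mset)
  then have N: "neg Y \<subseteq># mset (snd c)" using neg_mono by fastforce
  have sums: "sum_mset (neg Y) = sum_mset P" using assms(4) by (simp add: U)
  have pos: "\<forall>x\<in>#mset (fst c). 0 < x" "\<forall>x\<in>#mset (snd c). 0 < x"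
    using well_formed_letters[OF assms(1)] by auto
  have "sum_mset P = 0 \<or> sum_mset P = sum_list (fst c)"
    using assms(2) sum_in_subset_sums[OF P] sum_in_subset_sums[OF N] sums
    by (auto simp: indecomposable_def list_all_iff)
  then show ?thesis
  proof
    assume 0: "sum_mset P = 0"
    then have "P = {#}" using pos(1) P by (meson positive_sum_zero mset_subset_eqD)
    moreover have "neg Y = {#}" using pos(2) N sums 0 by (metis positive_sum_zero mset_subset_eqD)
    ultimately show ?thesis by (simp add: U)
  next
    assume *: "sum_mset P = sum_list (fst c)"
    have "mset (fst c) - P = {#}" "mset (snd c) - neg Y = {#}"
      using sums pos P N * assms(1)
      by (auto intro!: positive_sum_zero dest: in_diffD simp: sum_mset_diff sum_mset_sum_list
          well_formed_def)
    then have "P = mset (fst c)" "neg Y = mset (snd c)"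
      using P N by (metis Diff_eq_empty_iff_mset subset_mset.antisym)+
    then show ?thesis by (metis U word_def neg_simps(3))
  qed
qed

lemma atoms_eq:
  "atoms = insert {#0#} (word ` (set pair_codes \<union> set mixed_codes) \<union> neg ` word ` set mixed_codes)"
  by (simp add: atoms_def atom_codes_eq image_Un image_image word_swap)

lemma atom_cases:
  assumes "A \<in> atoms"
  obtains (zero) "A = {#0#}"
  | (code) c where "c \<in> set pair_codes \<union> set mixed_codes" "A = word c \<or> A = neg (word c)"
  using assms unfolding atoms_eq by blast

lemma well_formed_swap: "well_formed (prod.swap c) = well_formed c"
  by (auto simp: well_formed_def)

lemma atom_codes_well_formed: "c \<in> set atom_codes \<Longrightarrow> well_formed c"
  using well_formed_codes unfolding atom_codes_eq list_all_iff
      by (auto simp only: set_append well_formed_swap)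

lemma atom_balanced:
  assumes "A \<in> atoms"
  shows "balanced A" "A \<noteq> {#}"
proof -
  have *: "balanced (word c)" "word c \<noteq> {#}" if "c \<in> set pair_codes \<union> set mixed_codes" for c
  proof -
    have wf: "well_formed c" using that well_formed_codes
        by (auto simp only: list_all_iff set_append)
    then show "balanced (word c)"
      using well_formed_letters[OF wf]
      by (force simp: balanced_def word_def sum_mset_sum_list well_formed_def)
    have "\<forall>c \<in> set pair_codes \<union> set mixed_codes. fst c \<noteq> []"
      by (simp add: pair_codes_def mixed_codes_def)
    then show "word c \<noteq> {#}" using that by (auto simp: word_def)
  qed
  from assms show "balanced A"
      by (cases rule: atom_cases) (auto simp: balanced_def[of "{#0#}"] simp del: Un_iff dest!: *(1))
  from assms show "A \<noteq> {#}" by (cases rule: atom_cases) (auto simp del: Un_iff dest!: *(2))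
qed

lemma atom_indecomposable:
  assumes "A \<in> atoms" "balanced U" "U \<subseteq># A"
  shows "U = {#} \<or> U = A"
proof -
  have *: "U = {#} \<or> U = word c" if "c \<in> set pair_codes \<union> set mixed_codes" "balanced U"
      "U \<subseteq># word c" for c U
    using that well_formed_codes indecomposable_codes indecomposable_word[of c U]
    unfolding list_all_iff balanced_def set_append by blast
  from assms(1) show ?thesis
  proof (cases rule: atom_cases)
    case zero
    then show ?thesis using assms(3) by (metis nonempty_subseteq_mset_eq_single)
  next
    case (code c)
    from code(2) show ?thesis
    proof
      assume "A = word c" then show ?thesis using * code(1) assms by blast
    next
      assume A: "A = neg (word c)"
      then have "neg U \<subseteq># word c" using assms(3) neg_mono by fastforce
      then have "neg U = {#} \<or> neg U = word c" using *[OF code(1), of "neg U"] assms(2) by simp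
      then show ?thesis using A by (metis neg_simps(3,5))
    qed
  qed
qed

lemma neg_atom:
  assumes "A \<in> atoms"
  shows "neg A \<in> atoms"
  using assms
proof (cases rule: atom_cases)
  case (code c)
  have "neg (word c) = word c" if "c \<in> set pair_codes" for c
    using that by (auto simp: pair_codes_def word_def)
  then show ?thesis using code unfolding atoms_eq by (metis Un_iff image_eqI insertCI neg_simps(3))
qed (simp add: atoms_eq)

lemma filter_word:
  assumes "well_formed c"
  shows "filter_mset (\<lambda>x. 0 < x) (word c) = mset (fst c)"
    "filter_mset (\<lambda>x. 0 < x) (neg (word c)) = mset (snd c)"
proof -
  have *: "filter_mset (\<lambda>x. 0 < x) (mset xs) = mset xs" "filter_mset (\<lambda>x. x < 0) (mset xs) = {#}"
    if "\<forall>x\<in>set xs. 0 < x \<and> x \<le> 6" for xs :: "int list"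
    using that by (auto simp: filter_mset_eq_conv filter_mset_False[symmetric] intro!:
        filter_mset_cong)
  show "filter_mset (\<lambda>x. 0 < x) (word c) = mset (fst c)"
    "filter_mset (\<lambda>x. 0 < x) (neg (word c)) = mset (snd c)"
    using *[OF well_formed_letters(1)[OF assms]] *[OF well_formed_letters(2)[OF assms]]
    by (simp_all add: word_def neg_def filter_mset_image_mset multiset.map_comp comp_def)
qed

lemma sorted_list_eqI:
  fixes xs ys :: "int list"
  assumes "sorted_wrt (\<ge>) xs" "sorted_wrt (\<ge>) ys" "mset xs = mset ys"
  shows "xs = ys"
proof -
  have "sorted (rev xs)" "sorted (rev ys)" using assms(1,2) by (simp_all add: sorted_wrt_rev)
  then have "rev xs = rev ys" using assms(3) by (metis mset_rev properties_for_sort)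
  then show ?thesis by simp
qed

lemma word_inject:
  assumes "well_formed c" "well_formed d" "word c = word d"
  shows "c = d"
proof -
  have "mset (fst c) = mset (fst d)" "mset (snd c) = mset (snd d)"
    using filter_word[OF assms(1)] filter_word[OF assms(2)] assms(3) by simp_all
  then show ?thesis using assms(1,2)
      by (auto simp: well_formed_def prod_eq_iff intro: sorted_list_eqI)
qed

lemma word_subset:
  assumes "well_formed c" "word c \<subseteq># word d" "well_formed a" "well_formed b" "d = merge a b"
  shows "mset (fst c) \<subseteq># mset (fst d)" "mset (snd c) \<subseteq># mset (snd d)"
proof -
  have d: "word d = word a + word b" by (simp add: assms(5) merge_def word_def)
  show "mset (fst c) \<subseteq># mset (fst d)"
    using multiset_filter_mono[OF assms(2), of "\<lambda>x. 0 < x"] filter_word[OF assms(1)]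
        filter_word[OF assms(3)] filter_word[OF assms(4)]
    by (simp add: d) (simp add: assms(5) merge_def)
  show "mset (snd c) \<subseteq># mset (snd d)"
    using multiset_filter_mono[OF neg_mono[OF assms(2)], of "\<lambda>x. 0 < x"] filter_word[OF assms(1)]
        filter_word[OF assms(3)] filter_word[OF assms(4)]
    by (simp add: d) (simp add: assms(5) merge_def)
qed

lemma take_out_Some: "take_out xs ys = Some us \<Longrightarrow> mset ys = mset xs + mset us"
  by (induction xs ys rule: take_out.induct)
    (auto split: if_splits simp: List.member_iff, metis insert_DiffM set_mset_mset
        union_mset_add_mset_left)

lemma take_out_None: "take_out xs ys = None \<Longrightarrow> \<not> mset xs \<subseteq># mset ys"
proof (induction xs ys rule: take_out.induct)
  case (2 x xs ys)
  then show ?case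
    by (cases "x \<in> set ys") (auto simp: List.member_iff insert_subset_eq_iff)
qed simp

lemma word_merge: "word (merge a b) = word a + word b"
  by (simp add: merge_def word_def)

lemma remainder_Some: "remainder c d = Some e \<Longrightarrow> word d = word c + word e"
  by (auto simp: remainder_def word_def split: option.splits dest!: take_out_Some)

text \<open>The second finite check. The list is traversed as ordered pairs \<open>i < j\<close> only, so the cases
are stated symmetrically in \<open>a\<close> and \<open>b\<close>; an atom trivially shares its letters with itself.\<close>

lemma mixed_pair_cases:
  assumes "a \<in> set mixed_codes" "b \<in> set mixed_codes"
  obtains (meet) k where "k \<in># word a" "k \<in># word b \<or> - k \<in># word b"
  | (flip) A N k where "A \<in> atoms" "word a + word b = A + N" "k \<in># A" "k \<in># N"
  | (exceptional) "(a, b) \<in> set exceptional_pairs \<or> (b, a) \<in> set exceptional_pairs"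
proof -
  have share: "\<exists>k. k \<in># word c \<and> k \<in># word d" if "share_letter c d" for c d
    using that by (force simp: share_letter_def list_ex_iff List.member_iff word_def neg_def)
  have nonempty: "\<exists>k. k \<in># word c" if "c \<in> set mixed_codes" for c
    using atom_balanced(2)[of "word c"] that by (auto simp: atoms_def atom_codes_eq)
  have *: thesis if ab: "a = c \<and> b = d \<or> a = d \<and> b = c" and fl: "flippable c d" for c d
  proof -
    have sum: "word a + word b = word (merge c d)" using ab by (auto simp: word_merge add.commute)
    from fl consider "share_letter c d" | "share_letter c (prod.swap d)"
      | e f where "e \<in> set atom_codes" "remainder e (merge c d) = Some f" "share_letter e f"
      | "(c, d) \<in> set exceptional_pairs \<or> (d, c) \<in> set exceptional_pairs"
      by (auto simp: flippable_def list_ex_iff List.member_iff split: option.splits)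
    then show thesis
    proof cases
      case 1 then show thesis using share ab meet by blast
    next
      case 2
      then obtain k where "k \<in># word c" "- k \<in># word d" using share by (fastforce simp: word_swap)
      then show thesis using ab meet[of k] meet[of "- k"] by auto
    next
      case 3
      then obtain k where "k \<in># word e" "k \<in># word f" using share by blast
      then show thesis using flip[of "word e" "word f" k] remainder_Some[OF 3(2)] 3(1) sum
        by (auto simp: atoms_def)
    next
      case 4 then show thesis using ab exceptional by blast
    qed
  qed
  show thesis
  proof (cases "a = b")
    case True
    then show thesis using nonempty[OF assms(1)] meet by blast
  next
    case False
    obtain i j where ij: "i < length mixed_codes" "j < length mixed_codes" "a = mixed_codes ! i"
        "b = mixed_codes ! j"
      using assms by (auto simp: in_set_conv_nth)
    then consider "i < j" | "j < i" using False by (metis linorder_neqE_nat)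
    then show thesis
      using flippable_codes ij * unfolding sorted_wrt_iff_nth_less by cases blast+
  qed
qed

text \<open>Both a proper part \<open>U\<close> and its complement contain an atom, which has to be \<open>a\<close> or \<open>b\<close>. They
cannot contain the same one, for then one of the atoms would contain the other; so they are \<open>a\<close>
and \<open>b\<close>.\<close>

lemma splits_only_as_sound:
  assumes "splits_only_as a b" "a \<in> set atom_codes" "b \<in> set atom_codes" "word a \<noteq> word b"
    "balanced U" "U \<subseteq># word a + word b"
  shows "U \<in> {{#}, word a, word b, word a + word b}"
proof -
  let ?M = "word a + word b"
  have wf: "well_formed a" "well_formed b" using assms(2,3) atom_codes_well_formed by auto
  have at: "word a \<in> atoms" "word b \<in> atoms" using assms(2,3) by (auto simp: atoms_def)
  have only: "A = word a \<or> A = word b" if A: "A \<in> atoms" "A \<subseteq># ?M" for A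
  proof -
    have "0 \<notin># ?M"
      using well_formed_letters[OF wf(1)] well_formed_letters[OF wf(2)] by (auto simp: word_def)
    then have "A \<noteq> {#0#}" using A(2) by auto
    then obtain c where c: "c \<in> set atom_codes" "A = word c" using A(1) unfolding atoms_def by blast
    have "mset (fst c) \<subseteq># mset (fst (merge a b))" "mset (snd c) \<subseteq># mset (snd (merge a b))"
      using word_subset[OF atom_codes_well_formed[OF c(1)] _ wf refl] A(2) c(2)
          by (simp_all add: word_merge)
    then have "remainder c (merge a b) \<noteq> None"
      using take_out_None[of "fst c" "fst (merge a b)"] take_out_None[of "snd c" "snd (merge a b)"]
      by (cases "take_out (fst c) (fst (merge a b))"; cases "take_out (snd c) (snd (merge a b))")
        (simp_all add: remainder_def)
    then show ?thesis using assms(1) c by (auto simp: splits_only_as_def list_all_iff)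
  qed
  define V where "V = ?M - U"
  have M: "?M = U + V" using assms(6) by (simp add: V_def)
  have "balanced ?M" using at atom_balanced balanced_add by blast
  then have "balanced V" using assms(5,6) balanced_diff by (simp add: V_def)
  show ?thesis
  proof (cases "U = {#} \<or> V = {#}")
    case True then show ?thesis using M by auto
  next
    case False
    obtain X where X: "X \<in> atoms" "X \<subseteq># U" using contains_atom assms(5) False by blast
    obtain Y where Y: "Y \<in> atoms" "Y \<subseteq># V" using contains_atom \<open>balanced V\<close> False by blast
    have XY: "X + Y \<subseteq># ?M" using X Y M by (simp add: subset_mset.add_mono)
    have "X = word a \<or> X = word b" "Y = word a \<or> Y = word b"
      using only X Y M
          by (metis mset_subset_eq_add_left mset_subset_eq_add_right subset_mset.order_trans)+
    moreover have "\<not> word a \<subseteq># word b" "\<not> word b \<subseteq># word a"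
      using atom_indecomposable at atom_balanced assms(4) by metis+
    ultimately have "X + Y = ?M" using XY by (auto simp: add.commute)
    moreover obtain U' V' where "U = X + U'" "V = Y + V'"
      using X(2) Y(2) by (metis mset_subset_eq_exists_conv)
    ultimately have "U = X" using M by (simp add: union_assoc union_lcomm)
    then show ?thesis using \<open>X = word a \<or> X = word b\<close> by auto
  qed
qed

section \<open>Independence of monomials\<close>

definition mon :: "int multiset \<Rightarrow> (int \<Rightarrow> complex) \<Rightarrow> complex"
  where "mon M y = (\<Prod>k\<in>#M. y k)"

text \<open>The points at which monomials are evaluated: the value of an opposite letter is the
conjugate value.\<close>

definition real_points :: "(int \<Rightarrow> complex) set"
  where "real_points = {y. \<forall>k. y (- k) = cnj (y k)}"

lemma mon_simps [simp]:
  "mon {#} y = 1" "mon (add_mset k M) y = y k * mon M y" "mon (M + N) y = mon M y * mon N y"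
  by (simp_all add: mon_def)

lemma mon_mult: "mon M (\<lambda>k. x k * y k) = mon M x * mon M y"
  by (induction M) auto

lemma mon_neg: "y \<in> real_points \<Longrightarrow> mon (neg M) y = cnj (mon M y)"
  by (induction M) (auto simp: real_points_def)

lemma mon_cong: "(\<And>k. k \<in># M \<Longrightarrow> x k = y k) \<Longrightarrow> mon M x = mon M y"
  unfolding mon_def by (metis image_mset_cong)

lemma mon_single_letter:
  assumes "\<And>j. j \<noteq> k \<Longrightarrow> j \<noteq> - k \<Longrightarrow> y j = 1"
  shows "mon M y = (if k = 0 then y 0 ^ count M 0 else y k ^ count M k * y (- k) ^ count M (- k))"
  using assms by (induction M) auto

lemma two_power_inject: "(2::complex) ^ m = 2 ^ n \<longleftrightarrow> m = n"
proof -
  have "(2::complex) ^ m = 2 ^ n \<longleftrightarrow> of_nat (2 ^ m) = (of_nat (2 ^ n) :: complex)" by simp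
  then show ?thesis by (simp only: of_nat_eq_iff) simp
qed

text \<open>Only one letter \<open>k\<close> and its opposite get a value \<open>t\<close> other than \<open>1\<close>, and the monomial
becomes \<open>t ^ a * cnj t ^ b\<close>. Taking \<open>t = 2\<close> detects \<open>a + b\<close>. If the sums \<open>a + b\<close> agree, a suitable
\<open>t\<close> on the unit circle detects \<open>a - b\<close>.\<close>

lemma separating_point:
  assumes "M \<noteq> N"
  obtains y where "y \<in> real_points" "mon M y \<noteq> mon N y"
proof -
  from assms obtain k where k: "count M k \<noteq> count N k" by (auto simp: multiset_eq_iff)
  define y where "y t = (\<lambda>j. if j = k then t else if j = - k then cnj t else (1::complex))" for t
  have mon: "mon L (y t) = t ^ count L k * cnj t ^ count L (- k)" if "k \<noteq> 0" for L t
    using mon_single_letter[of k "y t" L] that by (simp add: y_def)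
  show thesis
  proof (cases "k = 0")
    case True
    have "y 2 \<in> real_points" by (auto simp: real_points_def y_def True)
    moreover have "mon M (y 2) \<noteq> mon N (y 2)"
      using mon_single_letter[of k "y 2"] k by (simp add: y_def True two_power_inject)
    ultimately show thesis by (rule that)
  next
    case False
    have real: "y t \<in> real_points" for t using False by (auto simp: real_points_def y_def)
    show thesis
    proof (cases "count M k + count M (- k) = count N k + count N (- k)")
      case False
      moreover have "mon L (y 2) = 2 ^ (count L k + count L (- k))" for L
        using mon[OF \<open>k \<noteq> 0\<close>, of L 2] unfolding power_add complex_cnj_numeral .
      ultimately have "mon M (y 2) \<noteq> mon N (y 2)" by (metis two_power_inject)
      then show thesis using real that by blast
    next
      case True
      define d where "d = int (count M k) - int (count N k)"
      define t where "t = cis (pi / (2 * of_int d))"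
      have d: "d \<noteq> 0" using k by (simp add: d_def)
      have pw: "mon L (y t) = cis ((real (count L k) - real (count L (- k))) *
          (pi / (2 * of_int d)))" for L
        unfolding mon[OF \<open>k \<noteq> 0\<close>] t_def cis_cnj Complex.DeMoivre cis_mult
        by (rule arg_cong[of _ _ cis]) (simp add: left_diff_distrib diff_divide_distrib)
      have "real (count M k) - real (count M (- k)) = real (count N k) - real (count N (- k)) +
          2 * of_int d"
        using True by (simp add: d_def)
      then have "mon M (y t) = mon N (y t) * cis (2 * of_int d * (pi / (2 * of_int d)))"
        unfolding pw by (simp only: cis_mult ring_distribs)
      also have "\<dots> = - mon N (y t)" using d by simp
      finally have "mon M (y t) = - mon N (y t)" .
      moreover have "mon N (y t) \<noteq> 0" by (simp add: pw)
      ultimately have "mon M (y t) \<noteq> mon N (y t)" by auto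
      then show thesis using real that by blast
    qed
  qed
qed

text \<open>Artin's argument for the linear independence of characters: from a relation, translated by a
point \<open>x\<close> that separates two monomials, subtract a multiple of the relation itself; one monomial
disappears and the coefficient of the other is only multiplied by a nonzero number.\<close>

lemma monomials_independent:
  assumes "finite S" "\<And>y. y \<in> real_points \<Longrightarrow> (\<Sum>M\<in>S. c M * mon M y) = 0" "M \<in> S"
  shows "c M = 0"
  using assms
proof (induction S arbitrary: c M rule: finite_induct)
  case (insert N S)
  have one: "(\<lambda>_. 1) \<in> real_points" by (simp add: real_points_def)
  have c0: "c K = 0" if K: "K \<in> S" for K
  proof -
    obtain x where x: "x \<in> real_points" "mon K x \<noteq> mon N x"
      using separating_point[of K N] K insert.hyps(2) by blast
    have "c K * (mon K x - mon N x) = 0"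
    proof (rule insert.IH[OF _ K])
      fix y assume y: "y \<in> real_points"
      then have xy: "(\<lambda>k. x k * y k) \<in> real_points" using x(1) by (simp add: real_points_def)
      \<comment> \<open>The combination in which the term of \<open>N\<close> cancels.\<close>
      have "0 = (\<Sum>M\<in>insert N S. c M * mon M (\<lambda>k. x k * y k)) - mon N x * (\<Sum>M\<in>insert N S.
          c M * mon M y)"
        using insert.prems(1)[OF xy] insert.prems(1)[OF y] by simp
      also have "\<dots> = (\<Sum>M\<in>S. c M * (mon M x - mon N x) * mon M y)"
        using insert.hyps by (simp add: mon_mult sum_distrib_left sum_subtractf algebra_simps)
      finally show "(\<Sum>M\<in>S. c M * (mon M x - mon N x) * mon M y) = 0" by simp
    qed
    then show ?thesis using x(2) by simp
  qed
  then have "c N = 0" using insert.prems(1)[OF one] insert.hyps by (simp add: mon_def)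
  then show ?case using c0 insert.prems(2) by blast
qed simp

section \<open>Coefficients and convolution\<close>

text \<open>Polynomials are treated as functions from monomials to coefficients.\<close>

definition supp :: "(int multiset \<Rightarrow> complex) \<Rightarrow> int multiset set"
  where "supp c = {M. c M \<noteq> 0}"

definition evaluate :: "(int multiset \<Rightarrow> complex) \<Rightarrow> (int \<Rightarrow> complex) \<Rightarrow> complex"
  where "evaluate c y = (\<Sum>M\<in>supp c. c M * mon M y)"

lemma evaluate_superset: "finite S \<Longrightarrow> supp c \<subseteq> S \<Longrightarrow> evaluate c y = (\<Sum>M\<in>S. c M * mon M y)"
  unfolding evaluate_def by (rule sum.mono_neutral_left) (auto simp: supp_def)

definition convolution ::
    "(int multiset \<Rightarrow> complex) \<Rightarrow> (int multiset \<Rightarrow> complex) \<Rightarrow> int multiset \<Rightarrow> complex"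
  where "convolution p q M = (\<Sum>U | U \<subseteq># M. p U * q (M - U))"

lemma finite_submultisets [simp]: "finite {U. U \<subseteq># M}"
proof -
  have "{U. U \<subseteq># M} \<subseteq> mset ` {xs. set xs \<subseteq> set_mset M \<and> length xs \<le> size M}"
  proof
    fix U assume "U \<in> {U. U \<subseteq># M}"
    moreover obtain xs where "mset xs = U" by (metis ex_mset)
    ultimately show "U \<in> mset ` {xs. set xs \<subseteq> set_mset M \<and> length xs \<le> size M}"
      by (auto intro!: image_eqI[of _ _ xs] dest: mset_subset_eqD size_mset_mono)
  qed
  then show ?thesis by (rule finite_subset) (simp add: finite_lists_length_le)
qed

lemma convolution_nonzero:
  assumes "convolution p q M \<noteq> 0"
  obtains U V where "U \<in> supp p" "V \<in> supp q" "M = U + V"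
proof -
  from assms obtain U where "U \<subseteq># M" "p U * q (M - U) \<noteq> 0"
    unfolding convolution_def by (metis (mono_tags, lifting) mem_Collect_eq sum.neutral)
  then show thesis using that[of U "M - U"] by (simp add: supp_def)
qed

lemma supp_convolution: "supp (convolution p q) \<subseteq> (\<lambda>(U, V). U + V) ` (supp p \<times> supp q)"
  by (force simp: supp_def[of "convolution p q"] elim: convolution_nonzero)

lemma evaluate_convolution:
  assumes "finite (supp p)" "finite (supp q)"
  shows "evaluate (convolution p q) y = evaluate p y * evaluate q y"
proof -
  define S where "S = (\<lambda>(U, V). U + V) ` (supp p \<times> supp q)"
  have fin: "finite S" using assms by (simp add: S_def)
  have "evaluate p y * evaluate q y = (\<Sum>(U, V)\<in>supp p \<times> supp q. p U * q V * mon (U + V) y)"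
    unfolding evaluate_def sum_product sum.cartesian_product by (simp add: ac_simps)
  also have "\<dots> = (\<Sum>(M, U)\<in>Sigma S (\<lambda>M. {U. U \<subseteq># M}). p U * q (M - U) * mon M y)"
  proof (rule sum.reindex_bij_witness_not_neutral[where
        i = "\<lambda>(M, U). (U, M - U)" and j = "\<lambda>(U, V). (U + V, U)" and S' = "{}"
        and T' = "{(M, U) \<in> Sigma S (\<lambda>M. {U. U \<subseteq># M}). p U * q (M - U) = 0}"])
    show "finite {(M, U) \<in> Sigma S (\<lambda>M. {U. U \<subseteq># M}). p U * q (M - U) = 0}"
      by (rule finite_subset[OF _ finite_SigmaI[OF fin finite_submultisets]]) auto
  qed (auto simp: S_def supp_def split: prod.splits)
  also have "\<dots> = (\<Sum>M\<in>S. convolution p q M * mon M y)"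
    using fin by (simp add: convolution_def sum_distrib_right sum.Sigma)
  also have "\<dots> = evaluate (convolution p q) y"
    using supp_convolution fin by (intro evaluate_superset[symmetric]) (auto simp: S_def)
  finally show ?thesis by simp
qed

lemma convolution_neg:
  assumes p: "\<And>M. p (neg M) = s * p M" and q: "\<And>M. q (neg M) = s * q M" and s: "s * s = 1"
  shows "convolution p q (neg M) = convolution p q M"
  unfolding convolution_def
proof (rule sum.reindex_bij_witness[of _ neg neg])
  fix U assume "U \<in> {U. U \<subseteq># neg M}"
  then have U: "U \<subseteq># neg M" by simp
  then have "neg U \<subseteq># M" using neg_mono by fastforce
  then have "neg (M - neg U) = neg M - U"
    using image_mset_Diff[of "neg U" M uminus] by (simp add: neg_def[symmetric])
  then have "q (neg M - U) = s * q (M - neg U)" "p U = s * p (neg U)"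
      by (metis q, metis p neg_simps(3))
  then show "p (neg U) * q (M - neg U) = p U * q (neg M - U)"
    using s by (simp add: mult.assoc mult.left_commute)
  show "neg U \<in> {U. U \<subseteq># M}" using \<open>neg U \<subseteq># M\<close> by simp
qed (simp_all add: neg_mono)

section \<open>The generators and their coefficients\<close>

definition generator_codes :: "code list"
  where "generator_codes = ([0], []) # pair_codes @ mixed_codes"

lemma generator_atom: "c \<in> set generator_codes \<Longrightarrow> word c \<in> atoms"
  unfolding generator_codes_def atoms_eq by (auto simp: word_def[of "([0], [])"] simp del: Un_iff)

lemma mixed_atom: "c \<in> set mixed_codes \<Longrightarrow> word c \<in> atoms"
  by (simp add: atoms_eq)

lemma atom_generator_cases:
  assumes "A \<in> atoms"
  obtains c where "c \<in> set generator_codes" "A = word c \<or> A = neg (word c)"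
    "c \<in> set mixed_codes \<or> neg (word c) = word c"
  using assms
proof (cases rule: atom_cases)
  case zero
  show thesis by (rule that[of "([0], [])"]) (simp_all add: generator_codes_def zero word_def)
next
  case (code c)
  have "neg (word c) = word c" if "c \<in> set pair_codes"
    using that by (auto simp: pair_codes_def word_def)
  moreover have "c \<in> set generator_codes" using code(1) by (simp add: generator_codes_def)
  ultimately show thesis using code that by blast
qed

lemma mixed_ne_neg:
  assumes "c \<in> set mixed_codes" "d \<in> set mixed_codes"
  shows "word c \<noteq> neg (word d)"
proof
  assume "word c = neg (word d)"
  then have "c = prod.swap d"
    using assms atom_codes_well_formed by (intro word_inject) (auto simp: word_swap atom_codes_eq)
  then show False using assms distinct_codes by auto
qed

lemma generator_word_inject:
  assumes "c \<in> set generator_codes" "d \<in> set generator_codes"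
      "word c = word d \<or> word c = neg (word d)"
  shows "c = d"
proof -
  have wf: "well_formed c" "prod.swap c \<in> set atom_codes" if "c \<in> set generator_codes"
      "c \<noteq> ([0], [])" for c
  proof -
    have c: "c \<in> set pair_codes \<union> set mixed_codes" using that by (simp add: generator_codes_def)
    then show "well_formed c" using atom_codes_well_formed unfolding atom_codes_eq by blast
    have "prod.swap c = c" if "c \<in> set pair_codes" using that by (auto simp: pair_codes_def)
    then show "prod.swap c \<in> set atom_codes" using c unfolding atom_codes_eq
        by (metis Un_iff image_eqI)
  qed
  have zero: "word ([0], []) = {#0#}" by (simp add: word_def)
  have ne0: "word c \<noteq> {#0#}" "neg (word c) \<noteq> {#0#}" if "c \<in> set generator_codes" "c \<noteq> ([0], [])"
      for c
  proof -
    have "0 \<notin># word c" using well_formed_letters[OF wf(1)[OF that]] by (auto simp: word_def)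
    then show "word c \<noteq> {#0#}" "neg (word c) \<noteq> {#0#}"
        by (metis neg_simps(1,3,4) minus_zero union_single_eq_member)+
  qed
  consider "c = ([0], [])" "d = ([0], [])" | "c \<noteq> ([0], [])" "d \<noteq> ([0], [])"
    using ne0[OF assms(1)] ne0[OF assms(2)] assms(3) zero
    by (metis neg_simps(1,3,4) minus_zero)
  then show ?thesis
  proof cases
    case 2
    have sw: "word c = word (prod.swap d) \<Longrightarrow> c = prod.swap d"
      using wf[OF assms(1) 2(1)] wf[OF assms(2) 2(2)] word_inject atom_codes_well_formed by blast
    have unmix: "prod.swap e = e" if "e \<in> set pair_codes" for e
      using that by (auto simp: pair_codes_def)
    have "c = d \<or> c = prod.swap d"
      using assms(3) sw word_inject[OF wf(1)[OF assms(1) 2(1)] wf(1)[OF assms(2) 2(2)]]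
      unfolding word_swap by blast
    then show ?thesis
    proof
      assume cd: "c = prod.swap d"
      then have "word c = neg (word d)" by (simp add: word_swap)
      then have "c \<in> set pair_codes \<or> d \<in> set pair_codes"
        using 2 assms(1,2) mixed_ne_neg[of c d] unfolding generator_codes_def by simp blast
      moreover have "prod.swap c = d" by (simp add: cd)
      ultimately show "c = d" using unmix[of c] unmix[of d] cd by metis
    qed
  qed simp
qed

lemma exceptional_mixed:
  assumes "(a, b) \<in> set exceptional_pairs"
  shows "a \<in> set mixed_codes" "b \<in> set mixed_codes" "splits_only_as a b"
      "splits_only_as a (prod.swap b)"
  using bspec[OF exceptional_codes[unfolded list_all_iff] assms] by (simp_all add: List.member_iff)

lemma exceptional_pairs_distinct:
  assumes "(a, b) \<in> set exceptional_pairs"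
  shows "a \<noteq> b" "(b, a) \<notin> set exceptional_pairs"
proof -
  have "\<forall>(a, b) \<in> set exceptional_pairs. a \<noteq> b \<and> (b, a) \<notin> set exceptional_pairs"
    by (simp add: exceptional_pairs_def)
  from bspec[OF this assms] show "a \<noteq> b" "(b, a) \<notin> set exceptional_pairs" by auto
qed

text \<open>The coefficients of the rotation-invariant polynomials.\<close>

definition balanced_coeffs :: "(int multiset \<Rightarrow> complex) \<Rightarrow> bool"
  where "balanced_coeffs c \<longleftrightarrow> (\<forall>M. c M \<noteq> 0 \<longrightarrow> balanced M)"

lemma balanced_coeffs_convolution:
  "balanced_coeffs p \<Longrightarrow> balanced_coeffs q \<Longrightarrow> balanced_coeffs (convolution p q)"
  unfolding balanced_coeffs_def
      by (auto simp: supp_def intro!: balanced_add elim!: convolution_nonzero)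

lemma convolution_balanced:
  assumes "balanced_coeffs p" "finite S" "{U. U \<subseteq># M \<and> balanced U} \<subseteq> S" "S \<subseteq> {U. U \<subseteq># M}"
  shows "convolution p q M = (\<Sum>U\<in>S. p U * q (M - U))"
  unfolding convolution_def
  by (rule sum.mono_neutral_right) (use assms in \<open>auto simp: balanced_coeffs_def\<close>)

lemma convolution_empty: "convolution p q {#} = p {#} * q {#}"
  by (simp add: convolution_def)

text \<open>An atom has only the two trivial splittings, so taking its coefficient is a derivation at
the augmentation \<open>p {#}\<close>.\<close>

lemma convolution_atom:
  assumes "balanced_coeffs p" "A \<in> atoms"
  shows "convolution p q A = p {#} * q A + p A * q {#}"
  using convolution_balanced[OF assms(1), of "{{#}, A}" A q] atom_indecomposable[OF assms(2)]
    atom_balanced(2)[OF assms(2)] by auto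

lemma exceptional_splits:
  assumes ab: "(a, b) \<in> set exceptional_pairs" and B: "B = word b \<or> B = neg (word b)"
    and U: "balanced U" "U \<subseteq># word a + B"
  shows "U \<in> {{#}, word a, B, word a + B}"
proof -
  note m = exceptional_mixed[OF ab]
  have ne: "word a \<noteq> word b" "word a \<noteq> word (prod.swap b)"
    using mixed_ne_neg[OF m(1,2)] generator_word_inject[of a b] m exceptional_pairs_distinct[OF ab]
    by (auto simp: word_swap generator_codes_def)
  have at: "a \<in> set atom_codes" "b \<in> set atom_codes" "prod.swap b \<in> set atom_codes"
    using m by (auto simp: atom_codes_eq)
  from B show ?thesis
  proof
    assume "B = word b"
    then show ?thesis using splits_only_as_sound[OF m(3) at(1,2) ne(1)] U by simp
  next
    assume "B = neg (word b)"
    then show ?thesis using splits_only_as_sound[OF m(4) at(1,3) ne(2)] U by (simp add: word_swap)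
  qed
qed

text \<open>The product rule behind the indispensability of \<open>Im A * Im B\<close>: for conjugation-symmetric
coefficients the right-hand side has the same form for \<open>B\<close> and \<open>neg B\<close>.\<close>

lemma convolution_exceptional:
  assumes "(a, b) \<in> set exceptional_pairs" "B = word b \<or> B = neg (word b)" "balanced_coeffs p"
  shows "convolution p q (word a + B) =
    p {#} * q (word a + B) + p (word a) * q B + p B * q (word a) + p (word a + B) * q {#}"
proof -
  let ?A = "word a"
  note m = exceptional_mixed[OF assms(1)]
  have ne: "?A \<noteq> B"
    using mixed_ne_neg[OF m(1,2)] generator_word_inject[of a b] m
        exceptional_pairs_distinct[OF assms(1)] assms(2)
    by (auto simp: generator_codes_def)
  have nz: "?A \<noteq> {#}" "B \<noteq> {#}"
      using atom_balanced(2)[OF mixed_atom[OF m(1)]] atom_balanced(2)[OF mixed_atom[OF m(2)]]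
      assms(2) by auto
  have "convolution p q (?A + B) = (\<Sum>U\<in>{{#}, ?A, B, ?A + B}. p U * q (?A + B - U))"
    using exceptional_splits[OF assms(1,2)] by (intro convolution_balanced assms(3)) auto
  then show ?thesis using ne nz by (simp add: algebra_simps)
qed

definition const_coeff :: "real \<Rightarrow> int multiset \<Rightarrow> complex"
  where "const_coeff r M = (if M = {#} then of_real r else 0)"

text \<open>Coefficients of \<open>(M + neg M) / 2\<close> and \<open>(M - neg M) / (2 * \<i>)\<close>. For \<open>neg M = M\<close> the two
summands coincide, and the formulas still give \<open>M\<close> and \<open>0\<close>.\<close>

definition re_coeff :: "int multiset \<Rightarrow> int multiset \<Rightarrow> complex"
  where "re_coeff M N = (of_bool (N = M) + of_bool (N = neg M)) / 2"

definition im_coeff :: "int multiset \<Rightarrow> int multiset \<Rightarrow> complex"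
  where "im_coeff M N = (of_bool (N = M) - of_bool (N = neg M)) / (2 * \<i>)"

lemma coeff_neg: "re_coeff M (neg N) = re_coeff M N" "im_coeff M (neg N) = - im_coeff M N"
proof -
  have "neg N = M \<longleftrightarrow> N = neg M" "neg N = neg M \<longleftrightarrow> N = M" by (metis neg_simps(3))+
  then show "re_coeff M (neg N) = re_coeff M N" "im_coeff M (neg N) = - im_coeff M N"
    by (auto simp: re_coeff_def im_coeff_def of_bool_def)
qed

lemma balanced_coeffs_simps:
  "balanced_coeffs (const_coeff r)"
  "balanced M \<Longrightarrow> balanced_coeffs (re_coeff M)" "balanced M \<Longrightarrow> balanced_coeffs (im_coeff M)"
  "balanced_coeffs p \<Longrightarrow> balanced_coeffs q \<Longrightarrow> balanced_coeffs (\<lambda>M. p M + q M)"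
proof -
  show "balanced_coeffs (const_coeff r)"
    by (simp add: balanced_coeffs_def const_coeff_def balanced_def)
  show "balanced M \<Longrightarrow> balanced_coeffs (re_coeff M)" "balanced M \<Longrightarrow> balanced_coeffs (im_coeff M)"
    unfolding balanced_coeffs_def re_coeff_def im_coeff_def
        by (auto split: if_splits simp: of_bool_def)
  show "balanced_coeffs p \<Longrightarrow> balanced_coeffs q \<Longrightarrow> balanced_coeffs (\<lambda>M. p M + q M)"
    unfolding balanced_coeffs_def by (metis add_cancel_right_right)
qed

section \<open>Functions with given coefficients\<close>

text \<open>A domain \<open>V\<close> on which the letters can take all values that are compatible with conjugation.\<close>

locale point_family =
  fixes V :: "'a set" and pt :: "'a \<Rightarrow> int \<Rightarrow> complex"
  assumes pt_real: "T \<in> V \<Longrightarrow> pt T \<in> real_points"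
    and pt_surj: "y \<in> real_points \<Longrightarrow> \<exists>T\<in>V. \<forall>k\<in>{-6..6}. pt T k = y k"
begin

text \<open>Only letters in \<open>{-6..6}\<close> are admitted, because nothing is assumed about the values of \<open>pt\<close>
at other letters.\<close>

definition represents :: "(int multiset \<Rightarrow> complex) \<Rightarrow> ('a \<Rightarrow> real) \<Rightarrow> bool"
  where "represents c f \<longleftrightarrow> finite (supp c) \<and> (\<forall>M\<in>supp c. set_mset M \<subseteq> {-6..6}) \<and>
    (\<forall>T\<in>V. of_real (f T) = evaluate c (pt T))"

text \<open>The surjectivity of \<open>pt\<close> turns equality of functions on \<open>V\<close> into a linear relation between
monomials at all real points.\<close>

lemma represents_unique:
  assumes "represents c f" "represents d f"
  shows "c = d"
proof
  fix M
  let ?S = "supp c \<union> supp d"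
  have fin: "finite ?S" using assms by (simp add: represents_def)
  have "(\<Sum>M\<in>?S. (c M - d M) * mon M y) = 0" if y: "y \<in> real_points" for y
  proof -
    obtain T where T: "T \<in> V" "\<forall>k\<in>{-6..6}. pt T k = y k" using pt_surj[OF y] by blast
    have "mon M y = mon M (pt T)" if "M \<in> ?S" for M
    proof (rule mon_cong)
      fix k assume "k \<in># M"
      then have "k \<in> {-6..6}" using that assms unfolding represents_def by blast
      then show "y k = pt T k" using T(2) by simp
    qed
    then have "(\<Sum>M\<in>?S. (c M - d M) * mon M y) = (\<Sum>M\<in>?S. (c M - d M) * mon M (pt T))"
      by simp
    also have "\<dots> = evaluate c (pt T) - evaluate d (pt T)"
      using fin by (simp add: evaluate_superset[of ?S] left_diff_distrib sum_subtractf)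
    also have "\<dots> = 0" using assms T(1) by (simp add: represents_def)
    finally show ?thesis .
  qed
  then have "c M - d M = 0" if "M \<in> ?S" by (rule monomials_independent[OF fin _ that])
  then show "c M = d M" by (cases "M \<in> ?S") (auto simp: supp_def)
qed

lemma represents_cong: "represents c f \<Longrightarrow> (\<And>T. T \<in> V \<Longrightarrow> f T = g T) \<Longrightarrow> represents c g"
  by (simp add: represents_def)

lemma represents_restrict [simp]: "represents c (restrict f V) \<longleftrightarrow> represents c f"
  by (auto simp: represents_def)

lemma represents_const: "represents (const_coeff r) (\<lambda>T. r)"
proof -
  have s: "supp (const_coeff r) \<subseteq> {{#}}" by (auto simp: supp_def const_coeff_def split: if_splits)
  then show ?thesis
    using finite_subset[OF s]
        by (auto simp: represents_def evaluate_superset[OF _ s] const_coeff_def)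
qed

lemma represents_add:
  assumes "represents c f" "represents d g"
  shows "represents (\<lambda>M. c M + d M) (\<lambda>T. f T + g T)"
proof -
  have s: "supp (\<lambda>M. c M + d M) \<subseteq> supp c \<union> supp d" by (auto simp: supp_def)
  have fin: "finite (supp c \<union> supp d)" using assms by (simp add: represents_def)
  have "of_real (f T + g T) = evaluate (\<lambda>M. c M + d M) (pt T)" if "T \<in> V" for T
    using assms that
    by (simp add: represents_def evaluate_superset[OF fin] s distrib_right sum.distrib)
  moreover have "\<forall>M\<in>supp (\<lambda>M. c M + d M). set_mset M \<subseteq> {-6..6}"
    using assms s unfolding represents_def by blast
  ultimately show ?thesis
    using finite_subset[OF s fin] unfolding represents_def by blast
qed

lemma represents_mult:
  assumes "represents c f" "represents d g"
  shows "represents (convolution c d) (\<lambda>T. f T * g T)"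
  unfolding represents_def
proof (intro conjI ballI)
  show "finite (supp (convolution c d))"
    using assms by (intro finite_subset[OF supp_convolution]) (simp add: represents_def)
  show "set_mset M \<subseteq> {-6..6}" if "M \<in> supp (convolution c d)" for M
    using assms subsetD[OF supp_convolution that] by (fastforce simp: represents_def)
  show "of_real (f T * g T) = evaluate (convolution c d) (pt T)" if "T \<in> V" for T
    using assms that by (simp add: represents_def evaluate_convolution)
qed

definition Re_mon :: "int multiset \<Rightarrow> 'a \<Rightarrow> real" where "Re_mon M T = Re (mon M (pt T))"
definition Im_mon :: "int multiset \<Rightarrow> 'a \<Rightarrow> real" where "Im_mon M T = Im (mon M (pt T))"

lemma represents_Re_Im:
  assumes "set_mset M \<subseteq> {-6..6}"
  shows "represents (re_coeff M) (Re_mon M)" "represents (im_coeff M) (Im_mon M)"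
proof -
  have s: "supp (re_coeff M) \<subseteq> {M, neg M}" "supp (im_coeff M) \<subseteq> {M, neg M}"
    by (auto simp: supp_def re_coeff_def im_coeff_def)
  have letters: "set_mset N \<subseteq> {-6..6}" if "N \<in> {M, neg M}" for N using that assms by force
  have ev: "evaluate (re_coeff M) (pt T) = of_real (Re_mon M T)"
    "evaluate (im_coeff M) (pt T) = of_real (Im_mon M T)" if T: "T \<in> V" for T
  proof -
    let ?z = "mon M (pt T)"
    have "?z + cnj ?z = of_real (2 * Re ?z)" by (rule complex_add_cnj)
    moreover have "?z - cnj ?z = of_real (2 * Im ?z) * \<i>" by (rule complex_diff_cnj)
    ultimately show "evaluate (re_coeff M) (pt T) = of_real (Re_mon M T)"
      "evaluate (im_coeff M) (pt T) = of_real (Im_mon M T)"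
      using mon_neg[OF pt_real[OF T], of M]
      by (cases "neg M = M"; auto simp: evaluate_superset[OF _ s(1)] evaluate_superset[OF _ s(2)]
        re_coeff_def im_coeff_def Re_mon_def Im_mon_def field_simps)+
  qed
  have fin: "finite (supp (re_coeff M))" "finite (supp (im_coeff M))"
    using s finite_subset by blast+
  have supp: "\<forall>N\<in>supp (re_coeff M). set_mset N \<subseteq> {-6..6}"
      "\<forall>N\<in>supp (im_coeff M). set_mset N \<subseteq> {-6..6}"
    using s letters by blast+
  show "represents (re_coeff M) (Re_mon M)" "represents (im_coeff M) (Im_mon M)"
    unfolding represents_def using fin supp ev[symmetric] by blast+
qed

text \<open>A property \<open>Q\<close> of coefficients which holds for constants and is preserved by sums and
products defines a subalgebra.\<close>

lemma generated_represented:
  assumes "f \<in> generated_algebra V B"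
    and "\<And>g. g \<in> B \<Longrightarrow> \<exists>c. represents c g \<and> balanced_coeffs c \<and> Q c"
    and "\<And>r. Q (const_coeff r)"
    and "\<And>c d. Q c \<Longrightarrow> Q d \<Longrightarrow> Q (\<lambda>M. c M + d M)"
    and "\<And>c d. Q c \<Longrightarrow> Q d \<Longrightarrow> balanced_coeffs c \<Longrightarrow> balanced_coeffs d \<Longrightarrow> Q (convolution c d)"
  shows "\<exists>c. represents c f \<and> balanced_coeffs c \<and> Q c"
  using assms(1)
proof induction
  case (const r)
  then show ?case
    using assms(3) represents_const balanced_coeffs_simps(1) by (metis represents_restrict)
next
  case (add f g)
  then show ?case
    using assms(4) represents_add balanced_coeffs_simps(4)
        by (metis (no_types, lifting) represents_restrict)
next
  case (mult f g)
  then show ?case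
    using assms(5) represents_mult balanced_coeffs_convolution
        by (metis (no_types, lifting) represents_restrict)
qed (use assms(2) in blast)

text \<open>The product rule at an atom shows that the invariants whose coefficient at \<open>A\<close> has vanishing
real (or imaginary) part form a subalgebra. The condition on \<open>c {#}\<close> keeps the constant terms
real, without which the product rule would mix real and imaginary parts.\<close>

lemma not_generated_atom:
  assumes h: "h = Re \<or> h = Im" and A: "A \<in> atoms"
    and B: "\<And>g. g \<in> B \<Longrightarrow> \<exists>c. represents c g \<and> balanced_coeffs c \<and> Im (c {#}) = 0 \<and> h (c A) = 0"
    and f: "represents d f" "h (d A) \<noteq> 0"
  shows "f \<notin> generated_algebra V B"
proof
  assume "f \<in> generated_algebra V B"
  then have "\<exists>c. represents c f \<and> balanced_coeffs c \<and> Im (c {#}) = 0 \<and> h (c A) = 0"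
  proof (rule generated_represented)
    show "Im (const_coeff r {#}) = 0 \<and> h (const_coeff r A) = 0" for r
      using h atom_balanced(2)[OF A] by (auto simp: const_coeff_def)
    show "Im (c {#} + d {#}) = 0 \<and> h (c A + d A) = 0"
      if "Im (c {#}) = 0 \<and> h (c A) = 0" "Im (d {#}) = 0 \<and> h (d A) = 0" for c d
      using that h by auto
    show "Im (convolution c d {#}) = 0 \<and> h (convolution c d A) = 0"
      if "Im (c {#}) = 0 \<and> h (c A) = 0" "Im (d {#}) = 0 \<and> h (d A) = 0" "balanced_coeffs c" for c d
      using that h by (auto simp: convolution_empty convolution_atom[OF _ A])
  qed (use B in auto)
  then show False using f represents_unique by blast
qed

text \<open>The subalgebra of the conjugation-symmetric invariants with equal coefficients at \<open>A + B\<close>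
and at \<open>A + neg B\<close>.\<close>

lemma not_generated_pair:
  assumes ab: "(a, b) \<in> set exceptional_pairs"
    and B: "\<And>g. g \<in> B \<Longrightarrow> \<exists>c. represents c g \<and> balanced_coeffs c \<and> (\<forall>M. c (neg M) = c M) \<and>
      c (word a + word b) = c (word a + neg (word b))"
    and f: "represents d f" "d (word a + word b) \<noteq> d (word a + neg (word b))"
  shows "f \<notin> generated_algebra V B"
proof
  let ?M = "word a + word b" and ?N = "word a + neg (word b)"
  assume "f \<in> generated_algebra V B"
  then have "\<exists>c. represents c f \<and> balanced_coeffs c \<and> (\<forall>M. c (neg M) = c M) \<and> c ?M = c ?N"
  proof (rule generated_represented)
    have nz: "word a \<noteq> {#}" using atom_balanced(2)[OF mixed_atom] exceptional_mixed[OF ab] by blast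
    then show "(\<forall>M. const_coeff r (neg M) = const_coeff r M) \<and> const_coeff r ?M = const_coeff r ?N"
        for r
      by (simp add: const_coeff_def)
    show "(\<forall>M. convolution c d (neg M) = convolution c d M) \<and> convolution c d ?M =
        convolution c d ?N"
      if "(\<forall>M. c (neg M) = c M) \<and> c ?M = c ?N" "(\<forall>M. d (neg M) = d M) \<and> d ?M = d ?N"
          "balanced_coeffs c" for c d
      using that convolution_neg[of c 1 d]
        convolution_exceptional[OF ab, of "word b" c d] convolution_exceptional[OF ab,
            of "neg (word b)" c d]
      by simp
  qed (use B in auto)
  then show False using f represents_unique by metis
qed

end

section \<open>Generation\<close>

text \<open>Minimality reduces to the statement that no member of the family is generated by the others.
As a member equal to another one would be generated by it, the same statement yields the number of
elements.\<close>

lemma minimal_integrity_basis_family: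
  assumes fin: "finite I" and inv: "\<And>i. i \<in> I \<Longrightarrow> g i \<in> Inv V G act"
      "\<And>i. i \<in> I \<Longrightarrow> homogeneous_on V (g i)"
    and gen: "generated_algebra V (g ` I) = Inv V G act"
    and indep: "\<And>i. i \<in> I \<Longrightarrow> g i \<notin> generated_algebra V (g ` (I - {i}))"
  shows "minimal_integrity_basis V G act (g ` I) \<and> card (g ` I) = card I"
proof -
  have mono: "f \<in> generated_algebra V C" if "f \<in> generated_algebra V B" "B \<subseteq> C" for f :: "_ \<Rightarrow> real"
      and B C
    using that(1)
  proof induction
    case (gen f)
    then show ?case using that(2) by (blast intro: generated_algebra.gen)
  qed (rule generated_algebra.const generated_algebra.add generated_algebra.mult; assumption)+
  have "inj_on g I"
  proof (rule inj_onI, rule ccontr)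
    fix i j assume ij: "i \<in> I" "j \<in> I" "g i = g j" "i \<noteq> j"
    have "g j \<in> g ` (I - {i})" using ij(2,4) by (intro imageI) simp
    then have "g i \<in> generated_algebra V (g ` (I - {i}))" unfolding ij(3)
        by (rule generated_algebra.gen)
    then show False using indep[OF ij(1)] by simp
  qed
  then have card: "card (g ` I) = card I" by (rule card_image)
  have "generated_algebra V B' \<noteq> Inv V G act" if B': "B' \<subset> g ` I" for B'
  proof -
    obtain i where i: "i \<in> I" "g i \<notin> B'" using B' by blast
    then have "B' \<subseteq> g ` (I - {i})" using B' by blast
    then have "g i \<notin> generated_algebra V B'" using mono indep[OF i(1)] by blast
    then show ?thesis using inv(1)[OF i(1)] by auto
  qed
  moreover have "integrity_basis V G act (g ` I)"
    using fin inv gen unfolding integrity_basis_def by auto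
  ultimately show ?thesis using card unfolding minimal_integrity_basis_def by simp
qed

lemma pair_atom:
  assumes "k \<in> {-6..6}" "k \<noteq> 0"
  shows "{#k, - k#} \<in> atoms"
proof -
  have "([\<bar>k\<bar>], [\<bar>k\<bar>]) \<in> set pair_codes" using assms
      by (auto simp: pair_codes_def intro!: image_eqI[of _ _ "\<bar>k\<bar>"])
  moreover have "word ([\<bar>k\<bar>], [\<bar>k\<bar>]) = {#k, - k#}" by (cases "k > 0") (simp_all add: word_def)
  ultimately show ?thesis unfolding atoms_eq by (metis UnI1 image_eqI insertCI)
qed

context point_family
begin

text \<open>Membership up to restriction, which makes the closure rules free of restrictions.\<close>

definition alg :: "('a \<Rightarrow> real) set \<Rightarrow> ('a \<Rightarrow> real) \<Rightarrow> bool"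
  where "alg B f \<longleftrightarrow> restrict f V \<in> generated_algebra V B"

lemma alg_cong: "alg B f \<Longrightarrow> (\<And>T. T \<in> V \<Longrightarrow> f T = g T) \<Longrightarrow> alg B g"
  unfolding alg_def by (metis (mono_tags, lifting) restrict_ext)

lemma alg_const: "alg B (\<lambda>T. r)"
  unfolding alg_def by (rule generated_algebra.const)

lemma alg_gen: "restrict f V \<in> B \<Longrightarrow> alg B f"
  unfolding alg_def by (rule generated_algebra.gen)

lemma alg_add: assumes "alg B f" "alg B g" shows "alg B (\<lambda>T. f T + g T)"
proof -
  have "restrict (\<lambda>T. f T + g T) V = restrict (\<lambda>T. restrict f V T + restrict g V T) V" by auto
  then show ?thesis using assms unfolding alg_def by (simp only: generated_algebra.add)
qed

lemma alg_mult: assumes "alg B f" "alg B g" shows "alg B (\<lambda>T. f T * g T)"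
proof -
  have "restrict (\<lambda>T. f T * g T) V = restrict (\<lambda>T. restrict f V T * restrict g V T) V" by auto
  then show ?thesis using assms unfolding alg_def by (simp only: generated_algebra.mult)
qed

lemma alg_diff: assumes "alg B f" "alg B g" shows "alg B (\<lambda>T. f T - g T)"
  using alg_add[OF assms(1) alg_mult[OF alg_const[of B "- 1"] assms(2)]] by simp

lemma alg_sum: "finite S \<Longrightarrow> (\<And>i. i \<in> S \<Longrightarrow> alg B (f i)) \<Longrightarrow> alg B (\<lambda>T. \<Sum>i\<in>S. f i T)"
  by (induction S rule: finite_induct) (simp_all add: alg_const alg_add)

lemma Re_Im_mon_simps:
  "Re_mon (M + N) T = Re_mon M T * Re_mon N T - Im_mon M T * Im_mon N T"
  "Im_mon (M + N) T = Re_mon M T * Im_mon N T + Im_mon M T * Re_mon N T"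
  "Re_mon {#} T = 1" "Im_mon {#} T = 0"
  by (simp_all add: Re_mon_def Im_mon_def)

lemma Re_Im_mon_neg:
  assumes "T \<in> V"
  shows "Re_mon (neg M) T = Re_mon M T" "Im_mon (neg M) T = - Im_mon M T"
  using mon_neg[OF pt_real[OF assms], of M] by (simp_all add: Re_mon_def Im_mon_def)

lemma alg_neg: "alg B (Re_mon (neg M)) \<longleftrightarrow> alg B (Re_mon M)"
  by (auto elim!: alg_cong simp: Re_Im_mon_neg)

lemma alg_Re_atom:
  assumes "\<And>c. c \<in> set generator_codes \<Longrightarrow> restrict (Re_mon (word c)) V \<in> B" "A \<in> atoms"
  shows "alg B (Re_mon A)"
  using assms(2) by (cases rule: atom_generator_cases) (metis alg_gen alg_neg assms(1))

text \<open>Induction on the degree: an atom splits off, and the real and imaginary parts of a product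
are polynomials in those of the factors.\<close>

lemma SO2_monomials_generated:
  assumes re: "\<And>c. c \<in> set generator_codes \<Longrightarrow> restrict (Re_mon (word c)) V \<in> B"
    and im: "\<And>c. c \<in> set mixed_codes \<Longrightarrow> restrict (Im_mon (word c)) V \<in> B"
    and "balanced M"
  shows "alg B (Re_mon M) \<and> alg B (Im_mon M)"
  using assms(3)
proof (induction "size M" arbitrary: M rule: less_induct)
  case less
  have im_atom: "alg B (Im_mon A)" if "A \<in> atoms" for A
    using that
  proof (cases rule: atom_generator_cases)
    case (1 c)
    have "alg B (Im_mon (word c))"
    proof (cases "neg (word c) = word c")
      case True
      then have "0 = Im_mon (word c) T" if "T \<in> V" for T
          using Re_Im_mon_neg(2)[OF that, of "word c"] by simp
      then show ?thesis using alg_cong[OF alg_const[of B 0]] by blast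
    next
      case False
      then show ?thesis using 1 im alg_gen by blast
    qed
    then have "alg B (Im_mon (word c)) \<and> alg B (\<lambda>T. - 1 * Im_mon (word c) T)"
      using alg_mult[OF alg_const] by blast
    then show ?thesis
      using 1(2) alg_cong[of B "\<lambda>T. - 1 * Im_mon (word c) T" "Im_mon A"]
          by (auto simp: Re_Im_mon_neg)
  qed
  show ?case
  proof (cases "M = {#}")
    case True
    then show ?thesis
      using alg_cong[OF alg_const[of B 1], of "Re_mon M"] alg_cong[OF alg_const[of B 0],
          of "Im_mon M"]
      by (simp add: Re_Im_mon_simps)
  next
    case False
    then obtain A where A: "A \<in> atoms" "A \<subseteq># M" using contains_atom less.prems by blast
    define N where "N = M - A"
    have M: "M = A + N" using A(2) by (simp add: N_def)
    have "balanced N" using balanced_diff[OF less.prems atom_balanced(1)] A by (simp add: N_def)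
    moreover have "size N < size M" using atom_balanced(2)[OF A(1)]
        by (simp add: M nonempty_has_size)
    ultimately have "alg B (Re_mon N)" "alg B (Im_mon N)" using less.hyps by blast+
    then show ?thesis
      using alg_Re_atom[OF re A(1)] im_atom[OF A(1)]
      unfolding M Re_Im_mon_simps(1,2)[abs_def] by (intro conjI alg_add alg_mult alg_diff)
  qed
qed

text \<open>Induction on the degree. The rule \<open>flip_sum\<close> allows negating one of two factors at the cost
of a sign, and \<open>cancel\<close> treats monomials with a pair of opposite letters in different factors.\<close>

lemma O2_monomials_generated:
  assumes re: "\<And>c. c \<in> set generator_codes \<Longrightarrow> restrict (Re_mon (word c)) V \<in> B"
    and im: "\<And>a b. (a, b) \<in> set exceptional_pairs \<Longrightarrow> restrict (\<lambda>T. Im_mon (word a) T * Im_mon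
        (word b) T) V \<in> B"
    and "balanced M"
  shows "alg B (Re_mon M)"
  using assms(3)
proof (induction "size M" arbitrary: M rule: less_induct)
  case less
  have flip_sum: "alg B (\<lambda>T. Re_mon (X + Y) T + Re_mon (neg X + Y) T)"
    if "alg B (Re_mon X)" "alg B (Re_mon Y)" for X Y
    by (rule alg_cong[OF alg_mult[OF alg_const[of B 2] alg_mult[OF that]]])
        (simp add: Re_Im_mon_simps Re_Im_mon_neg)
  have other: "alg B (Re_mon X)" if "alg B (\<lambda>T. Re_mon X T + Re_mon Y T)" "alg B (Re_mon Y)" for X Y
    by (rule alg_cong[OF alg_diff[OF that]]) simp
  have smaller: "alg B (Re_mon X)" if "balanced X" "size X < size M" for X
    using less.hyps that by blast
  have cancel: "alg B (Re_mon (P + Q))"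
    if X: "balanced P" "balanced Q" "size P + size Q = size M" "k \<in># P" "- k \<in># Q" for P Q k
  proof -
    let ?D = "{#k, - k#}"
    define X where "X = P + Q"
    have X_balanced: "balanced X" using that by (simp add: X_def balanced_add)
    have "{#k#} + {#- k#} \<subseteq># X" unfolding X_def using that by (intro subset_mset.add_mono) simp_all
    then have sub: "?D \<subseteq># X" by (simp add: add_mset_commute)
    define Y where "Y = X - ?D"
    have XY: "X = ?D + Y" unfolding Y_def by (rule subset_mset.add_diff_inverse[OF sub, symmetric])
    have "k \<in> {-6..6}" using X(1,4) by (auto simp: balanced_def)
    then have D: "balanced ?D" by (auto simp: balanced_def)
    have Y: "balanced Y" "size Y < size M"
      using balanced_diff[OF X_balanced D sub] X(3)
          unfolding Y_def[symmetric] size_union[symmetric] X_def[symmetric]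
      by (auto simp: XY)
    have im0: "Im_mon ?D T = 0" if "T \<in> V" for T
      using pt_real[OF that] by (simp add: Im_mon_def real_points_def mult.commute)
    have "alg B (Re_mon ?D)"
    proof (cases "k = 0")
      case True
      have z: "alg B (Re_mon {#0#})" using alg_Re_atom[OF re] by (simp add: atoms_def)
      have "Im_mon {#0#} T = 0" if "T \<in> V" for T using Re_Im_mon_neg(2)[OF that, of "{#0#}"] by simp
      then show ?thesis using Re_Im_mon_simps(1)[of "{#0#}" "{#0#}"]
        by (intro alg_cong[OF alg_mult[OF z z]]) (simp add: True)
    next
      case False
      then show ?thesis using alg_Re_atom[OF re] pair_atom \<open>k \<in> {-6..6}\<close> by blast
    qed
    then have "alg B (\<lambda>T. Re_mon ?D T * Re_mon Y T)" using smaller[OF Y] alg_mult by blast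
    then show ?thesis unfolding X_def[symmetric]
        by (rule alg_cong) (simp add: XY Re_Im_mon_simps(1) im0 del: union_mset_add_mset_left
        union_mset_add_mset_right)
  qed
  show ?case
  proof (cases "M = {#}")
    case True
    then show ?thesis using alg_const[of B 1] by (auto elim!: alg_cong simp: Re_Im_mon_simps)
  next
    case False
    then obtain A where A: "A \<in> atoms" "A \<subseteq># M" using contains_atom less.prems by blast
    define N where "N = M - A"
    have M: "M = A + N" using A(2) by (simp add: N_def)
    have bal: "balanced A" "balanced N"
      using balanced_diff[OF less.prems atom_balanced(1)] A atom_balanced by (simp_all add: N_def)
    have A_alg: "alg B (Re_mon A)" using alg_Re_atom[OF re A(1)] .
    have ltN: "size N < size M" using atom_balanced(2)[OF A(1)] by (simp add: M nonempty_has_size)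
    show ?thesis
    proof (cases "N = {#}")
      case True then show ?thesis using A_alg M by simp
    next
      case N: False
      then obtain A' where A': "A' \<in> atoms" "A' \<subseteq># N" using contains_atom bal by blast
      define C where "C = N - A'"
      have N: "N = A' + C" using A'(2) by (simp add: C_def)
      have balC: "balanced C" using balanced_diff[OF bal(2) atom_balanced(1)] A'
          by (simp add: C_def)
      have bal': "balanced A'" using A' atom_balanced by blast
      have nz: "A \<noteq> {#}" "A' \<noteq> {#}" using A A' atom_balanced by auto
      show ?thesis
      proof (cases "C = {#}")
        case False
        \<comment> \<open>Negating \<open>A\<close> changes the sign, and so does negating \<open>A'\<close>. But the two results are
          exchanged by negating \<open>C\<close> and conjugating, which changes the sign as well.\<close>
        have s1: "alg B (\<lambda>T. Re_mon (A + (A' + C)) T + Re_mon (neg A + (A' + C)) T)"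
          using flip_sum A_alg smaller[OF bal(2) ltN] N by simp
        have "alg B (Re_mon (A + C))" "alg B (Re_mon (neg A + A'))"
          using bal bal' balC False nz
          by (intro smaller balanced_add; simp add: M N nonempty_has_size)+
        moreover have "alg B (Re_mon C)" "alg B (Re_mon A')"
          using bal' balC nz by (intro smaller; simp add: M N nonempty_has_size)+
        ultimately have "alg B (\<lambda>T. Re_mon (A' + (A + C)) T + Re_mon (neg A' + (A + C)) T)"
          "alg B (\<lambda>T. Re_mon (neg A + A' + C) T + Re_mon (neg (neg A + A') + C) T)"
          using flip_sum by blast+
        note s = alg_mult[OF alg_const[of B "1/2"] alg_diff[OF alg_add[OF s1 this(1)] this(2)]]
        show ?thesis
          by (rule alg_cong[OF s]) (simp add: M N add.commute add.left_commute add.assoc)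
      next
        case True
        then have N: "N = A'" using N by simp
        have zero_or_neg: "neg X = X \<Longrightarrow> alg B (Re_mon X) \<Longrightarrow> alg B (Re_mon Y) \<Longrightarrow> alg B (Re_mon (X + Y))"
            for X Y
          using alg_mult[OF alg_const[of B "1/2"] flip_sum[of X Y]] by simp
        obtain a where a: "a \<in> set generator_codes" "A = word a \<or> A = neg (word a)"
            "a \<in> set mixed_codes \<or> neg (word a) = word a"
          using A(1) by (rule atom_generator_cases)
        obtain b where b: "b \<in> set generator_codes" "A' = word b \<or> A' = neg (word b)"
            "b \<in> set mixed_codes \<or> neg (word b) = word b"
          using A'(1) by (rule atom_generator_cases)
        have wa: "alg B (Re_mon (word a))" "alg B (Re_mon (word b))" using a b re alg_gen by blast+
        have szab: "size (word a) = size A" "size (word b) = size A'" "balanced (word a)"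
            "balanced (word b)"
          using a b bal bal' by auto
        have "alg B (Re_mon (word a + word b))"
        proof (cases "a \<in> set mixed_codes \<and> b \<in> set mixed_codes")
          case False
          then have "neg (word a) = word a \<or> neg (word b) = word b" using a b by blast
          then show ?thesis using zero_or_neg wa by (metis add.commute)
        next
          case True
          let ?X = "word a" and ?Y = "word b"
          from True have "a \<in> set mixed_codes" "b \<in> set mixed_codes" by auto
          then show ?thesis
          proof (cases rule: mixed_pair_cases)
            case (meet k)
            from meet(2) show ?thesis
            proof
              assume "- k \<in># ?Y"
              show ?thesis
                by (rule cancel[of _ _ k]) (use meet(1) \<open>- k \<in># ?Y\<close> szab in \<open>simp_all add: M N\<close>)
            next
              assume "k \<in># ?Y"
              have "alg B (Re_mon (neg ?X + ?Y))"
                by (rule cancel[of _ _ "- k"]) (use meet(1) \<open>k \<in># ?Y\<close> szab in \<open>simp_all add: M N\<close>)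
              then show ?thesis using other flip_sum wa by blast
            qed
          next
            case (flip D E k)
            have bE: "balanced D" "balanced E"
              using atom_balanced(1)[OF flip(1)] balanced_diff[OF balanced_add[OF szab(3,4)], of D]
              by (simp_all add: flip(2))
            have sz: "size D + size E = size M" using flip(2) szab by (metis M N size_union)
            have nz: "D \<noteq> {#}" "E \<noteq> {#}" using flip(3,4) by auto
            have "alg B (Re_mon (neg D + E))"
              by (rule cancel[of _ _ "- k"]) (use flip(3,4) bE sz in \<open>simp_all\<close>)
            moreover have "alg B (Re_mon D)" "alg B (Re_mon E)"
              using bE sz nz by (intro smaller; simp add: nonempty_has_size; fail)+
            ultimately show ?thesis unfolding flip(2) using other flip_sum by blast
          next
            case exceptional
            then have "alg B (\<lambda>T. Im_mon ?X T * Im_mon ?Y T)"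
            proof
              assume "(b, a) \<in> set exceptional_pairs"
              from alg_gen[OF im[OF this]] show ?thesis by (simp add: mult.commute)
            qed (rule alg_gen[OF im])
            from alg_diff[OF alg_mult[OF wa] this] show ?thesis
              by (rule alg_cong) (simp add: Re_Im_mon_simps)
          qed
        qed
        moreover from this have "alg B (Re_mon (neg (word a) + word b))"
          using flip_sum[OF wa] other[of "neg (word a) + word b" "word a + word b"]
              by (simp add: add.commute)
        ultimately have "alg B (Re_mon (A + A'))"
          using a(2) b(2) alg_neg[of B "word a + word b"] alg_neg[of B "neg (word a) + word b"]
              by auto
        then show ?thesis by (simp add: M N)
      qed
    qed
  qed
qed

section \<open>Independence of the generators\<close>

lemma coeff_simps:
  "Im (re_coeff M N) = 0" "Re (im_coeff M N) = 0"
  "M \<noteq> {#} \<Longrightarrow> re_coeff M {#} = 0" "M \<noteq> {#} \<Longrightarrow> im_coeff M {#} = 0"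
  "Re (re_coeff M M) \<noteq> 0" "neg M \<noteq> M \<Longrightarrow> im_coeff M M = - \<i> / 2"
proof -
  have e: "{#} = neg M \<longleftrightarrow> M = {#}" by (metis neg_simps(5))
  show "Im (re_coeff M N) = 0" "Re (im_coeff M N) = 0" "Re (re_coeff M M) \<noteq> 0"
    "neg M \<noteq> M \<Longrightarrow> im_coeff M M = - \<i> / 2"
    by (auto simp: re_coeff_def im_coeff_def of_bool_def)
  show "M \<noteq> {#} \<Longrightarrow> re_coeff M {#} = 0" "M \<noteq> {#} \<Longrightarrow> im_coeff M {#} = 0"
    by (simp_all add: re_coeff_def im_coeff_def e)
qed

lemma coeff_other_atom:
  assumes "c \<in> set generator_codes" "d \<in> set generator_codes" "c \<noteq> d"
  shows "re_coeff (word c) (word d) = 0" "im_coeff (word c) (word d) = 0"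
proof -
  have "word d \<noteq> word c" "word d \<noteq> neg (word c)"
    using generator_word_inject[OF assms(2,1)] assms(3) by auto
  then show "re_coeff (word c) (word d) = 0" "im_coeff (word c) (word d) = 0"
    by (simp_all add: re_coeff_def im_coeff_def)
qed

lemma mixed_generator: "c \<in> set mixed_codes \<Longrightarrow> c \<in> set generator_codes"
  by (simp add: generator_codes_def)

lemma word_nonempty: "c \<in> set generator_codes \<Longrightarrow> word c \<noteq> {#}"
  using generator_atom atom_balanced by blast

lemma Re_generator_coeff:
  assumes "c \<in> set generator_codes"
  shows "represents (re_coeff (word c)) (Re_mon (word c))" "balanced_coeffs (re_coeff (word c))"
  using atom_balanced(1)[OF generator_atom[OF assms]] represents_Re_Im balanced_coeffs_simps
  by (auto simp: balanced_def)

lemma Im_generator_coeff: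
  assumes "c \<in> set mixed_codes"
  shows "represents (im_coeff (word c)) (Im_mon (word c))" "balanced_coeffs (im_coeff (word c))"
  using atom_balanced(1)[OF mixed_atom[OF assms]] represents_Re_Im balanced_coeffs_simps
  by (auto simp: balanced_def)

definition product_coeff :: "code \<Rightarrow> code \<Rightarrow> int multiset \<Rightarrow> complex"
  where "product_coeff a b = convolution (im_coeff (word a)) (im_coeff (word b))"

lemma product_coeff:
  assumes "(a, b) \<in> set exceptional_pairs"
  shows "represents (product_coeff a b) (\<lambda>T. Im_mon (word a) T * Im_mon (word b) T)"
    "balanced_coeffs (product_coeff a b)"
    "product_coeff a b {#} = 0"
    "A \<in> atoms \<Longrightarrow> product_coeff a b A = 0"
    "product_coeff a b (neg M) = product_coeff a b M"
proof -
  note m = exceptional_mixed(1,2)[OF assms]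
  note rep = Im_generator_coeff[OF m(1)] Im_generator_coeff[OF m(2)]
  note nz = word_nonempty[OF mixed_generator[OF m(1)]] word_nonempty[OF mixed_generator[OF m(2)]]
  show "represents (product_coeff a b) (\<lambda>T. Im_mon (word a) T * Im_mon (word b) T)"
    "balanced_coeffs (product_coeff a b)"
    using rep represents_mult balanced_coeffs_convolution by (simp_all add: product_coeff_def)
  show "product_coeff a b {#} = 0" using nz
      by (simp add: product_coeff_def convolution_empty coeff_simps)
  show "A \<in> atoms \<Longrightarrow> product_coeff a b A = 0"
    using nz rep(2) by (simp add: product_coeff_def convolution_atom coeff_simps)
  show "product_coeff a b (neg M) = product_coeff a b M"
    unfolding product_coeff_def by (rule convolution_neg[of _ "- 1"]) (auto simp: coeff_neg)
qed

text \<open>Products of imaginary parts belonging to different exceptional pairs do not see each other's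
monomials; this makes the four functionals independent.\<close>

lemma product_coeff_sum:
  assumes ab: "(a, b) \<in> set exceptional_pairs" and cd: "(c, d) \<in> set exceptional_pairs"
    and B: "B = word b \<or> B = neg (word b)"
  shows "product_coeff c d (word a + B) =
    (if (a, b) = (c, d) then im_coeff (word a) (word a) * im_coeff (word b) B else 0)"
proof -
  have ma: "a \<in> set generator_codes" "b \<in> set generator_codes" "c \<in> set generator_codes"
      "d \<in> set generator_codes"
    using exceptional_mixed(1,2)[OF ab] exceptional_mixed(1,2)[OF cd] mixed_generator by blast+
  have zero: "im_coeff (word e) B = 0" if "e \<in> set generator_codes" "e \<noteq> b" for e
    using coeff_other_atom(2)[OF that(1) ma(2) that(2)] B by (auto simp: coeff_neg)
  have "product_coeff c d (word a + B) =
      im_coeff (word c) (word a) * im_coeff (word d) B + im_coeff (word c) B * im_coeff (word d)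
          (word a)"
    unfolding product_coeff_def
    using convolution_exceptional[OF ab B, of "im_coeff (word c)" "im_coeff (word d)"]
      Im_generator_coeff[OF exceptional_mixed(1)[OF cd]] word_nonempty ma by (simp add: coeff_simps)
  moreover have "a \<noteq> b" "(b, a) \<notin> set exceptional_pairs" using exceptional_pairs_distinct[OF ab]
      by auto
  then have "\<not> (c = b \<and> d = a)" using cd by auto
  ultimately show ?thesis
    using coeff_other_atom(2)[OF ma(3,1)] coeff_other_atom(2)[OF ma(4,1)] zero[OF ma(3)]
        zero[OF ma(4)] \<open>a \<noteq> b\<close>
    by (cases "c = a"; cases "d = b"; cases "c = b"; cases "d = a") auto
qed

text \<open>A sum of two atoms is not an atom.\<close>

lemma re_coeff_sum:
  assumes "(a, b) \<in> set exceptional_pairs" "c \<in> set generator_codes" "B = word b \<or> B = neg (word b)"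
  shows "re_coeff (word c) (word a + B) = 0"
proof -
  note m = exceptional_mixed(1,2)[OF assms(1)]
  have at: "word a \<in> atoms" "B \<in> atoms" using mixed_atom m assms(3) neg_atom by blast+
  have "word a + B \<noteq> A" if "A \<in> atoms" for A
    using atom_indecomposable[OF that, of "word a"] at atom_balanced by auto
  then have "word a + B \<noteq> word c" "word a + B \<noteq> neg (word c)"
    using generator_atom[OF assms(2)] neg_atom by blast+
  then show ?thesis by (simp add: re_coeff_def)
qed

definition SO2_family :: "code + code \<Rightarrow> 'a \<Rightarrow> real"
  where "SO2_family = case_sum (\<lambda>c. restrict (Re_mon (word c)) V) (\<lambda>c. restrict (Im_mon (word c))
      V)"

definition O2_family :: "code + code \<times> code \<Rightarrow> 'a \<Rightarrow> real"
  where "O2_family = case_sum (\<lambda>c. restrict (Re_mon (word c)) V)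
    (\<lambda>(a, b). restrict (\<lambda>T. Im_mon (word a) T * Im_mon (word b) T) V)"

text \<open>The real part of an atom is separated from the other generators by the real part of the
coefficient of this atom, the imaginary part by its imaginary part.\<close>

lemma SO2_family_independent:
  assumes "i \<in> set generator_codes <+> set mixed_codes"
  shows "SO2_family i \<notin> generated_algebra V (SO2_family ` ((set generator_codes <+> set mixed_codes)
      - {i}))"
  using assms
proof (cases i)
  case (Inl c)
  with assms have c: "c \<in> set generator_codes" by auto
  show ?thesis
  proof (rule not_generated_atom[of Re "word c" _ "re_coeff (word c)"])
    fix g assume "g \<in> SO2_family ` ((set generator_codes <+> set mixed_codes) - {i})"
    then obtain j where j: "j \<in> (set generator_codes <+> set mixed_codes) - {i}" "g = SO2_family j"
      by blast
    then consider d where "d \<in> set generator_codes" "d \<noteq> c" "g = restrict (Re_mon (word d)) V"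
      | d where "d \<in> set mixed_codes" "g = restrict (Im_mon (word d)) V"
      unfolding Inl SO2_family_def
      by (cases j) (auto simp only: Plus_def image_iff Diff_iff Un_iff singleton_iff sum.case
          sum.inject sum.distinct prod.case Pair_inject)
    then show "\<exists>e. represents e g \<and> balanced_coeffs e \<and> Im (e {#}) = 0 \<and> Re (e (word c)) = 0"
    proof cases
      case 1
      then show ?thesis using Re_generator_coeff[OF 1(1)] coeff_other_atom[OF 1(1) c 1(2)]
        by (intro exI[of _ "re_coeff (word d)"]) (simp add: coeff_simps)
    next
      case 2
      then show ?thesis using Im_generator_coeff[OF 2(1)] word_nonempty[OF mixed_generator[OF 2(1)]]
        by (intro exI[of _ "im_coeff (word d)"]) (simp add: coeff_simps)
    qed
  qed (use c generator_atom Re_generator_coeff in \<open>auto simp: coeff_simps SO2_family_def Inl\<close>)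
next
  case (Inr c)
  with assms have c: "c \<in> set mixed_codes" by auto
  show ?thesis
  proof (rule not_generated_atom[of Im "word c" _ "im_coeff (word c)"])
    fix g assume "g \<in> SO2_family ` ((set generator_codes <+> set mixed_codes) - {i})"
    then obtain j where j: "j \<in> (set generator_codes <+> set mixed_codes) - {i}" "g = SO2_family j"
      by blast
    then consider d where "d \<in> set generator_codes" "g = restrict (Re_mon (word d)) V"
      | d where "d \<in> set mixed_codes" "d \<noteq> c" "g = restrict (Im_mon (word d)) V"
      unfolding Inr SO2_family_def
      by (cases j) (auto simp only: Plus_def image_iff Diff_iff Un_iff singleton_iff sum.case
          sum.inject sum.distinct prod.case Pair_inject)
    then show "\<exists>e. represents e g \<and> balanced_coeffs e \<and> Im (e {#}) = 0 \<and> Im (e (word c)) = 0"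
    proof cases
      case 1
      then show ?thesis using Re_generator_coeff[OF 1(1)]
        by (intro exI[of _ "re_coeff (word d)"]) (simp add: coeff_simps)
    next
      case 2
      then show ?thesis using Im_generator_coeff[OF 2(1)] word_nonempty[OF mixed_generator[OF 2(1)]]
          coeff_other_atom[OF mixed_generator[OF 2(1)] mixed_generator[OF c] 2(2)]
        by (intro exI[of _ "im_coeff (word d)"]) (simp add: coeff_simps)
    qed
  qed (use c mixed_atom Im_generator_coeff mixed_ne_neg[OF c c] in \<open>auto simp: coeff_simps
      SO2_family_def Inr\<close>)
qed

text \<open>The products of imaginary parts have coefficient \<open>0\<close> at all atoms. Conversely the real parts
of the atoms have coefficient \<open>0\<close> at the sums of two atoms, so neither kind of separating
functional interferes with the other.\<close>

lemma O2_family_independent: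
  assumes "i \<in> set generator_codes <+> set exceptional_pairs"
  shows "O2_family i \<notin> generated_algebra V
      (O2_family ` ((set generator_codes <+> set exceptional_pairs) - {i}))"
proof (cases i)
  case (Inl c)
  with assms have c: "c \<in> set generator_codes" by auto
  show ?thesis
  proof (rule not_generated_atom[of Re "word c" _ "re_coeff (word c)"])
    fix g assume "g \<in> O2_family ` ((set generator_codes <+> set exceptional_pairs) - {i})"
    then obtain j where j: "j \<in> (set generator_codes <+> set exceptional_pairs) - {i}"
        "g = O2_family j"
      by blast
    then consider d where "d \<in> set generator_codes" "d \<noteq> c" "g = restrict (Re_mon (word d)) V"
      | a b where "(a, b) \<in> set exceptional_pairs"
          "g = restrict (\<lambda>T. Im_mon (word a) T * Im_mon (word b) T) V"
      unfolding Inl O2_family_def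
      by (cases j) (auto simp only: Plus_def image_iff Diff_iff Un_iff singleton_iff sum.case
          sum.inject sum.distinct prod.case Pair_inject)
    then show "\<exists>e. represents e g \<and> balanced_coeffs e \<and> Im (e {#}) = 0 \<and> Re (e (word c)) = 0"
    proof cases
      case 1
      then show ?thesis using Re_generator_coeff[OF 1(1)] coeff_other_atom[OF 1(1) c 1(2)]
        by (intro exI[of _ "re_coeff (word d)"]) (simp add: coeff_simps)
    next
      case 2
      then show ?thesis using product_coeff(1,2,3,4)[OF 2(1)] generator_atom[OF c]
        by (intro exI[of _ "product_coeff a b"]) simp
    qed
  qed (use c generator_atom Re_generator_coeff in \<open>auto simp: coeff_simps O2_family_def Inl\<close>)
next
  case (Inr p)
  obtain a b where p: "p = (a, b)" by (cases p)
  with assms Inr have ab: "(a, b) \<in> set exceptional_pairs" by auto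
  show ?thesis
  proof (rule not_generated_pair[OF ab, of _ "product_coeff a b"])
    fix g assume "g \<in> O2_family ` ((set generator_codes <+> set exceptional_pairs) - {i})"
    then obtain j where j: "j \<in> (set generator_codes <+> set exceptional_pairs) - {i}"
        "g = O2_family j"
      by blast
    then consider d where "d \<in> set generator_codes" "g = restrict (Re_mon (word d)) V"
      | c d where "(c, d) \<in> set exceptional_pairs" "(a, b) \<noteq> (c, d)"
          "g = restrict (\<lambda>T. Im_mon (word c) T * Im_mon (word d) T) V"
    proof (cases j)
      case (Inl d)
      with j that(1)[of d] show ?thesis by (auto simp add: O2_family_def)
    next
      case (Inr q)
      obtain c d where q: "q = (c, d)" by (cases q)
      with j that(2)[of c d] Inr show ?thesis by (auto simp add: O2_family_def \<open>i = Inr p\<close> p)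
    qed
    then show "\<exists>e. represents e g \<and> balanced_coeffs e \<and> (\<forall>M. e (neg M) = e M) \<and>
        e (word a + word b) = e (word a + neg (word b))"
    proof cases
      case 1
      then show ?thesis using Re_generator_coeff[OF 1(1)] re_coeff_sum[OF ab 1(1)]
        by (intro exI[of _ "re_coeff (word d)"]) (simp add: coeff_neg)
    next
      case 2
      then show ?thesis using product_coeff[OF 2(1)] product_coeff_sum[OF ab 2(1)]
        by (intro exI[of _ "product_coeff c d"]) auto
    qed
  next
    note m = exceptional_mixed(1,2)[OF ab]
    have "neg (word a) \<noteq> word a" "neg (word b) \<noteq> word b" using mixed_ne_neg m by metis+
    then show "product_coeff a b (word a + word b) \<noteq> product_coeff a b (word a + neg (word b))"
      using product_coeff_sum[OF ab ab] by (simp add: coeff_simps coeff_neg)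
  qed (use product_coeff(1)[OF ab] in \<open>simp add: O2_family_def Inr p\<close>)
qed

text \<open>A real function is the sum of the real parts of its terms, and the real part of \<open>c M * M\<close>
needs the imaginary part of \<open>M\<close> only if the coefficient is not real.\<close>

lemma generated_of_represents:
  assumes f: "represents c f" "f = restrict f V" and bal: "balanced_coeffs c"
    and re: "\<And>M. balanced M \<Longrightarrow> alg B (Re_mon M)"
    and im: "\<And>M. balanced M \<Longrightarrow> Im (c M) \<noteq> 0 \<Longrightarrow> alg B (Im_mon M)"
  shows "f \<in> generated_algebra V B"
proof -
  have fin: "finite (supp c)" using f(1) by (simp add: represents_def)
  have bal': "balanced M" if "M \<in> supp c" for M using bal that
      by (simp add: balanced_coeffs_def supp_def)
  have "alg B (\<lambda>T. \<Sum>M\<in>supp c. Re (c M) * Re_mon M T - Im (c M) * Im_mon M T)"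
  proof (rule alg_sum[OF fin])
    fix M assume M: "M \<in> supp c"
    have "alg B (\<lambda>T. Im (c M) * Im_mon M T)"
    proof (cases "Im (c M) = 0")
      case True then show ?thesis using alg_const[of B 0] by simp
    next
      case False then show ?thesis using alg_mult[OF alg_const im[OF bal'[OF M]]] by blast
    qed
    then show "alg B (\<lambda>T. Re (c M) * Re_mon M T - Im (c M) * Im_mon M T)"
      using alg_diff[OF alg_mult[OF alg_const re[OF bal'[OF M]]]] by blast
  qed
  moreover have "(\<Sum>M\<in>supp c. Re (c M) * Re_mon M T - Im (c M) * Im_mon M T) = f T" if "T \<in> V" for T
  proof -
    have "f T = Re (evaluate c (pt T))" using f(1) that unfolding represents_def
        by (metis Re_complex_of_real)
    then show ?thesis by (simp add: evaluate_def Re_mon_def Im_mon_def)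
  qed
  ultimately have "alg B f" by (rule alg_cong)
  then show ?thesis using f(2) unfolding alg_def by simp
qed

end

section \<open>Symmetric tensors and the orthogonal group\<close>

lemma generated_algebra_subset_Inv:
  assumes "B \<subseteq> Inv V G act" and act: "\<And>g x. g \<in> G \<Longrightarrow> x \<in> V \<Longrightarrow> act g x \<in> V"
  shows "generated_algebra V B \<subseteq> Inv V G act"
proof
  fix f assume "f \<in> generated_algebra V B"
  then show "f \<in> Inv V G act"
  proof induction
    case (const c)
    have "restrict (\<lambda>x. c) V \<in> polynomials_on V"
      unfolding polynomials_on_def by (blast intro: real_polynomial_function.intros)
    moreover have "restrict (\<lambda>x. c) V (act g x) = restrict (\<lambda>x. c) V x" if "g \<in> G" "x \<in> V" for g x
      using act that by simp
    ultimately show ?case unfolding Inv_def by blast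
  next
    case (gen f)
    then show ?case using assms(1) by blast
  next
    case (add f g)
    then obtain p q where pq: "real_polynomial_function p" "f = restrict p V"
        "real_polynomial_function q" "g = restrict q V"
      by (auto simp: Inv_def polynomials_on_def)
    have "restrict (\<lambda>x. f x + g x) V = restrict (\<lambda>x. p x + q x) V" by (auto simp: pq)
    then have "restrict (\<lambda>x. f x + g x) V \<in> polynomials_on V"
      unfolding polynomials_on_def using pq(1,3)
          by (blast intro: real_polynomial_function.intros(3))
    moreover have "restrict (\<lambda>x. f x + g x) V (act h x) = restrict (\<lambda>x. f x + g x) V x"
        if "h \<in> G" "x \<in> V" for h x
      using act that add by (simp add: Inv_def)
    ultimately show ?case unfolding Inv_def by blast
  next
    case (mult f g)
    then obtain p q where pq: "real_polynomial_function p" "f = restrict p V"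
        "real_polynomial_function q" "g = restrict q V"
      by (auto simp: Inv_def polynomials_on_def)
    have "restrict (\<lambda>x. f x * g x) V = restrict (\<lambda>x. p x * q x) V" by (auto simp: pq)
    then have "restrict (\<lambda>x. f x * g x) V \<in> polynomials_on V"
      unfolding polynomials_on_def using pq(1,3)
          by (blast intro: real_polynomial_function.intros(4))
    moreover have "restrict (\<lambda>x. f x * g x) V (act h x) = restrict (\<lambda>x. f x * g x) V x"
        if "h \<in> G" "x \<in> V" for h x
      using act that mult by (simp add: Inv_def)
    ultimately show ?case unfolding Inv_def by blast
  qed
qed

lemma subspace_Sym: "subspace (Sym :: 'k::finite tensor set)"
  by (auto simp: subspace_def Sym_def)

text \<open>A permutation of the slots can be moved from the free indices to the summation indices.\<close>

lemma tensor_act_Sym: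
  fixes T :: "'k::finite tensor"
  assumes "T \<in> Sym"
  shows "tensor_act g T \<in> Sym"
  unfolding Sym_def
proof (intro CollectI allI impI)
  fix p :: "'k \<Rightarrow> 'k" and i :: "'k \<Rightarrow> 2"
  assume p: "bij p"
  have "tensor_act g T $ (i \<circ> p) = (\<Sum>j\<in>UNIV. (\<Prod>s\<in>UNIV. g $ i (p s) $ j s) * T $ j)"
    by (simp add: tensor_act_def)
  also have "\<dots> = (\<Sum>j\<in>UNIV. (\<Prod>s\<in>UNIV. g $ i (p s) $ (j \<circ> p) s) * T $ (j \<circ> p))"
    by (rule sum.reindex_bij_witness[of _ "\<lambda>j. j \<circ> p" "\<lambda>j. j \<circ> inv p"])
      (use p in \<open>auto simp: comp_assoc bij_is_inj bij_is_surj surj_iff[symmetric] fun_eq_iff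
          surj_f_inv_f inv_f_f\<close>)
  also have "\<dots> = (\<Sum>j\<in>UNIV. (\<Prod>s\<in>UNIV. g $ i s $ j s) * T $ j)"
  proof (rule sum.cong[OF refl])
    fix j :: "'k \<Rightarrow> 2"
    have "(\<Prod>s\<in>UNIV. g $ i (p s) $ (j \<circ> p) s) = (\<Prod>s\<in>UNIV. g $ i s $ j s)"
      using prod.reindex_bij_betw[OF p, of "\<lambda>s. g $ i s $ j s"] by simp
    moreover have "T $ (j \<circ> p) = T $ j" using assms p by (simp add: Sym_def)
    ultimately show "(\<Prod>s\<in>UNIV. g $ i (p s) $ (j \<circ> p) s) * T $ (j \<circ> p) = (\<Prod>s\<in>UNIV. g $ i s $ j s) * T
        $ j" by simp
  qed
  finally show "tensor_act g T $ (i \<circ> p) = tensor_act g T $ i" by (simp add: tensor_act_def)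
qed

lemma det_rot: "det (rot \<theta>) = 1" "det (rot \<theta> ** refl_x) = - 1"
proof -
  show 1: "det (rot \<theta>) = 1" by (simp add: det_2 rot_def flip: power2_eq_square)
  have "det refl_x = - 1" by (simp add: det_2 refl_x_def)
  then show "det (rot \<theta> ** refl_x) = - 1" by (simp add: det_mul 1)
qed

lemma rot_O2: "rot \<theta> \<in> O2" "refl_x \<in> O2" "rot \<theta> ** refl_x \<in> O2"
proof -
  show "rot \<theta> \<in> O2"
    unfolding O2_def orthogonal_matrix mem_Collect_eq matrix_2_eq_iff
    by (simp add: matrix_matrix_mult_def transpose_def mat_def sum_2 rot_def flip: power2_eq_square)
  moreover show "refl_x \<in> O2"
    unfolding O2_def orthogonal_matrix mem_Collect_eq matrix_2_eq_iff
    by (simp add: matrix_matrix_mult_def transpose_def mat_def sum_2 refl_x_def)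
  ultimately show "rot \<theta> ** refl_x \<in> O2" by (simp add: O2_def orthogonal_matrix_mul)
qed

lemma SO2_eq: "SO2 = range rot"
proof
  show "SO2 \<subseteq> range rot"
  proof
    fix g assume g: "g \<in> SO2"
    then have "g \<in> O2" "det g = 1" by (auto simp: SO2_def O2_def rotation_matrix_def)
    then show "g \<in> range rot" by (cases rule: O2_cases) (auto simp: det_rot)
  qed
  show "range rot \<subseteq> SO2" using rot_O2(1) det_rot(1)
      by (auto simp: SO2_def O2_def rotation_matrix_def)
qed

definition monomial_of_code :: "code \<Rightarrow> (nat \<Rightarrow> complex) \<Rightarrow> complex"
  where "monomial_of_code c z =
    prod_list (map (\<lambda>k. z (nat (2 * k))) (fst c)) * prod_list (map (\<lambda>k. cnj (z (nat (2 * k))))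
        (snd c))"

text \<open>This identifies the list of codes with the list of monomials in the theorem.\<close>

lemma monomials_codes: "monomials = map monomial_of_code mixed_codes"
  by (simp add: monomials_def mixed_codes_def monomial_of_code_def fun_eq_iff power_numeral_reduce
      ac_simps)

lemma mon_mset: "mon (mset xs) y = prod_list (map y xs)"
  by (induction xs) auto

lemma mon_neg_mset: "mon (neg (mset xs)) y = prod_list (map (\<lambda>k. y (- k)) xs)"
  by (induction xs) auto

section \<open>Coordinates given by a harmonic decomposition\<close>

locale harmonic_coordinates =
  fixes l :: "12 tensor \<Rightarrow> real" and z :: "nat \<Rightarrow> 12 tensor \<Rightarrow> complex"
  assumes decomposition:
    "harmonic_decomposition (\<lambda>T. (l T, z 2 T, z 4 T, z 6 T, z 8 T, z 10 T, z 12 T))"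
begin

abbreviation "V \<equiv> Sym :: 12 tensor set"

definition \<phi> :: "12 tensor \<Rightarrow> harm"
  where "\<phi> T = (l T, z 2 T, z 4 T, z 6 T, z 8 T, z 10 T, z 12 T)"

text \<open>The value of the letter \<open>k\<close> at the tensor \<open>T\<close>, with the default \<open>0\<close> for integers that are
not letters.\<close>

definition pt :: "12 tensor \<Rightarrow> int \<Rightarrow> complex"
  where "pt T k = (if k = 0 then of_real (l T) else if k \<in> {1..6} then z (nat (2 * k)) T
    else if k \<in> {-6..-1} then cnj (z (nat (2 * - k)) T) else 0)"

lemma \<phi>_props:
  "S \<in> V \<Longrightarrow> T \<in> V \<Longrightarrow> \<phi> (S + T) = \<phi> S + \<phi> T" "T \<in> V \<Longrightarrow> \<phi> (c *\<^sub>R T) = c *\<^sub>R \<phi> T"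
  "bij_betw \<phi> V UNIV" "g \<in> O2 \<Longrightarrow> T \<in> V \<Longrightarrow> \<phi> (tensor_act g T) = harm_sum_act g (\<phi> T)"
  using decomposition unfolding harmonic_decomposition_def \<phi>_def[symmetric] by blast+

lemma pt_simps:
  "pt T 0 = of_real (l T)" "pt T 1 = z 2 T" "pt T 2 = z 4 T" "pt T 3 = z 6 T" "pt T 4 = z 8 T"
  "pt T 5 = z 10 T" "pt T 6 = z 12 T" "pt T (- k) = cnj (pt T k)"
  by (auto simp: pt_def)

lemma pt_outside: "6 < k \<Longrightarrow> pt T k = 0" "k < - 6 \<Longrightarrow> pt T k = 0"
    "\<not> k \<le> 6 \<Longrightarrow> pt T k = 0" "\<not> - 6 \<le> k \<Longrightarrow> pt T k = 0"
  by (auto simp: pt_def)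

lemma small_int_cases:
  fixes k :: int
  obtains "k = 0" | "k = 1" | "k = 2" | "k = 3" | "k = 4" | "k = 5" | "k = 6"
    | "k = - 1" | "k = - 2" | "k = - 3" | "k = - 4" | "k = - 5" | "k = - 6" | "k \<notin> {-6..6}"
proof -
  have "k = 0 \<or> k = 1 \<or> k = 2 \<or> k = 3 \<or> k = 4 \<or> k = 5 \<or> k = 6 \<or> k = - 1 \<or> k = - 2 \<or> k = - 3
      \<or> k = - 4 \<or> k = - 5 \<or> k = - 6 \<or> k < - 6 \<or> 6 < k" by presburger
  moreover have "k < - 6 \<or> 6 < k \<Longrightarrow> k \<notin> {-6..6}" by auto
  ultimately show thesis using that by metis
qed

text \<open>Identities between coordinates that respect conjugation need only be checked for the seven
components of the harmonic decomposition.\<close>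

lemma pt_eqI:
  assumes "\<And>k. f (- k) = cnj (f k)" "\<And>k. k \<notin> {-6..6} \<Longrightarrow> f k = 0"
    "of_real (l T) = f 0" "z 2 T = f 1" "z 4 T = f 2" "z 6 T = f 3" "z 8 T = f 4" "z 10 T = f 5"
        "z 12 T = f 6"
  shows "pt T k = f k"
proof -
  have "pt T k = f k" if "k \<ge> 0" for k
    using that assms(2-) pt_simps(1-7)
    by (cases k rule: small_int_cases) (auto simp: pt_def[of T k])
  then show ?thesis using assms(1)[of "- k"] pt_simps(8)[of T "- k"] by (cases "k \<ge> 0") simp_all
qed

sublocale point_family V pt
proof
  fix y assume y: "y \<in> real_points"
  have "(Re (y 0), y 1, y 2, y 3, y 4, y 5, y 6) \<in> \<phi> ` V"
    using bij_betw_imp_surj_on[OF \<phi>_props(3)] by simp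
  then obtain T where "(Re (y 0), y 1, y 2, y 3, y 4, y 5, y 6) = \<phi> T" and "T \<in> V" by (rule imageE)
  then have T: "T \<in> V" "\<phi> T = (Re (y 0), y 1, y 2, y 3, y 4, y 5, y 6)" by simp_all
  have cn: "y (- k) = cnj (y k)" for k using y by (simp add: real_points_def)
  have "of_real (Re (y 0)) = y 0" using cn[of 0] by (simp add: complex_eq_iff)
  then have "pt T k = y k" if "k \<in> {-6..6}" for k
    using T(2) that cn[of 1] cn[of 2] cn[of 3] cn[of 4] cn[of 5] cn[of 6]
    by (cases k rule: small_int_cases) (auto simp: \<phi>_def pt_simps)
  then show "\<exists>T\<in>V. \<forall>k\<in>{-6..6}. pt T k = y k" using T(1) by blast
qed (simp add: real_points_def pt_simps)

lemma pt_scale: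
  assumes "T \<in> V"
  shows "pt (c *\<^sub>R T) k = of_real c * pt T k"
proof -
  have "\<phi> (c *\<^sub>R T) = c *\<^sub>R \<phi> T" using \<phi>_props(2) assms .
  then show ?thesis
    by (intro pt_eqI) (auto simp: \<phi>_def pt_simps scaleR_conv_of_real complex_eq_iff pt_outside)
qed

lemma pt_rot:
  assumes "T \<in> V"
  shows "pt (tensor_act (rot \<theta>) T) k = cis (2 * of_int k * \<theta>) * pt T k"
proof -
  have "\<phi> (tensor_act (rot \<theta>) T) = harm_sum_act (rot \<theta>) (\<phi> T)" using \<phi>_props(4) rot_O2 assms
      by blast
  then show ?thesis
    by (intro pt_eqI) (auto simp: \<phi>_def pt_simps harm_act_rot cis_cnj pt_outside)
qed

lemma pt_rot_refl:
  assumes "T \<in> V"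
  shows "pt (tensor_act (rot \<theta> ** refl_x) T) k = cis (2 * of_int k * \<theta>) * pt T (- k)"
proof -
  have "\<phi> (tensor_act (rot \<theta> ** refl_x) T) = harm_sum_act (rot \<theta> ** refl_x) (\<phi> T)"
      using \<phi>_props(4) rot_O2 assms by blast
  then show ?thesis
    by (intro pt_eqI) (auto simp: \<phi>_def pt_simps harm_act_mult rot_O2 harm_act_rot harm_act_refl_x
        cis_cnj pt_outside)
qed

lemma mon_rot:
  assumes "T \<in> V"
  shows "mon M (pt (tensor_act (rot \<theta>) T)) = cis (2 * of_int (sum_mset M) * \<theta>) * mon M (pt T)"
    "mon M (pt (tensor_act (rot \<theta> ** refl_x) T)) = cis (2 * of_int (sum_mset M) * \<theta>) * mon (neg M)
        (pt T)"
proof -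
  have "(\<lambda>k. pt (tensor_act (rot \<theta>) T) k) = (\<lambda>k. cis (2 * of_int k * \<theta>) * pt T k)"
    "(\<lambda>k. pt (tensor_act (rot \<theta> ** refl_x) T) k) = (\<lambda>k. cis (2 * of_int k * \<theta>) * pt T (- k))"
    by (simp_all only: pt_rot[OF assms] pt_rot_refl[OF assms])
  moreover have "mon M (\<lambda>k. cis (2 * of_int k * \<theta>)) = cis (2 * of_int (sum_mset M) * \<theta>)"
    by (induction M) (simp_all add: cis_mult algebra_simps)
  moreover have "mon M (\<lambda>k. pt T (- k)) = mon (neg M) (pt T)" by (induction M) auto
  ultimately show "mon M (pt (tensor_act (rot \<theta>) T)) = cis (2 * of_int (sum_mset M) * \<theta>) * mon M
      (pt T)"
    "mon M (pt (tensor_act (rot \<theta> ** refl_x) T)) = cis (2 * of_int (sum_mset M) * \<theta>) * mon (neg M)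
        (pt T)"
    by (simp_all add: mon_mult)
qed

lemma mon_scale: "T \<in> V \<Longrightarrow> mon M (pt (c *\<^sub>R T)) = of_real c ^ size M * mon M (pt T)"
  by (induction M) (simp_all add: pt_scale)

definition \<psi> :: "harm \<Rightarrow> 12 tensor" where "\<psi> = the_inv_into V \<phi>"

lemma \<psi>: "\<psi> x \<in> V" "\<phi> (\<psi> x) = x" "T \<in> V \<Longrightarrow> \<psi> (\<phi> T) = T"
proof -
  have inj: "inj_on \<phi> V" and im: "\<phi> ` V = UNIV" using \<phi>_props(3) by (auto simp: bij_betw_def)
  show "\<psi> x \<in> V" unfolding \<psi>_def by (rule the_inv_into_into[OF inj]) (simp_all add: im)
  show "\<phi> (\<psi> x) = x" unfolding \<psi>_def by (rule f_the_inv_into_f[OF inj]) (simp add: im)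
  show "T \<in> V \<Longrightarrow> \<psi> (\<phi> T) = T" unfolding \<psi>_def by (rule the_inv_into_f_f[OF inj])
qed

lemma linear_\<psi>: "linear \<psi>"
proof
  show "\<psi> (x + y) = \<psi> x + \<psi> y" for x y
    using \<phi>_props(1)[of "\<psi> x" "\<psi> y"] \<psi>(3)[of "\<psi> x + \<psi> y"] subspace_add[OF subspace_Sym] \<psi>(1,2)
        by metis
  show "\<psi> (c *\<^sub>R x) = c *\<^sub>R \<psi> x" for c x
    using \<phi>_props(2)[of "\<psi> x" c] \<psi>(3)[of "c *\<^sub>R \<psi> x"] subspace_scale[OF subspace_Sym] \<psi>(1,2)
        by metis
qed

lemma \<phi>_extends: obtains \<Phi> :: "12 tensor \<Rightarrow> harm" where "linear \<Phi>" "\<And>T. T \<in> V \<Longrightarrow> \<Phi> T = \<phi> T"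
proof -
  have "inj \<psi>" by (metis \<psi>(2) injI)
  then obtain \<Phi> where "linear \<Phi>" "\<Phi> \<circ> \<psi> = id" using linear_injective_left_inverse[OF linear_\<psi>]
      by blast
  then show thesis using that \<psi>(3) by (metis comp_apply id_apply)
qed

text \<open>The coordinates are linear only on symmetric tensors. They become polynomial functions on
all tensors by means of a linear left inverse of the inverse \<open>\<psi>\<close> of the decomposition.\<close>

lemma coordinate_polynomial:
  "\<exists>p q. real_polynomial_function p \<and> real_polynomial_function q \<and>
    (\<forall>T\<in>V. Re (pt T k) = p T \<and> Im (pt T k) = q T)"
proof -
  obtain \<Phi> :: "12 tensor \<Rightarrow> harm" where \<Phi>: "linear \<Phi>" "\<And>T. T \<in> V \<Longrightarrow> \<Phi> T = \<phi> T" using \<phi>_extends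
      by blast
  let ?P = "\<lambda>f. \<exists>p q. real_polynomial_function p \<and> real_polynomial_function q \<and> (\<forall>T\<in>V. Re (f T) =
      p T \<and> Im (f T) = q T)"
  have lin: "?P (\<lambda>T. h (\<phi> T))" if "linear h" for h :: "harm \<Rightarrow> complex"
  proof -
    have "linear (\<lambda>T. h (\<Phi> T))" using linear_compose[OF \<Phi>(1) that] by (simp add: comp_def)
    then have "bounded_linear (\<lambda>T. h (\<Phi> T))" by (rule linear_conv_bounded_linear[THEN iffD1])
    then have "real_polynomial_function (\<lambda>T. Re (h (\<Phi> T)))"
        "real_polynomial_function (\<lambda>T. Im (h (\<Phi> T)))"
      by (rule real_polynomial_function.intros(1)[OF bounded_linear_compose[OF bounded_linear_Re]],
          rule real_polynomial_function.intros(1)[OF bounded_linear_compose[OF bounded_linear_Im]])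
    then show ?thesis using \<Phi>(2)
      by (intro exI[of _ "\<lambda>T. Re (h (\<Phi> T))"] exI[of _ "\<lambda>T. Im (h (\<Phi> T))"]) simp
  qed
  have coord: "linear (\<lambda>x::harm. of_real (fst x) :: complex)" "linear (\<lambda>x::harm. fst (snd x))"
    "linear (\<lambda>x::harm. fst (snd (snd x)))" "linear (\<lambda>x::harm. fst (snd (snd (snd x))))"
    "linear (\<lambda>x::harm. fst (snd (snd (snd (snd x)))))"
        "linear (\<lambda>x::harm. fst (snd (snd (snd (snd (snd x))))))"
    "linear (\<lambda>x::harm. snd (snd (snd (snd (snd (snd x))))))"
    by (auto intro!: linearI simp: scaleR_conv_of_real)
  have zero: "?P (\<lambda>T. 0)"
      by (intro exI[of _ "\<lambda>_. 0"]) (auto intro: real_polynomial_function.intros(2))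
  have small: "?P (\<lambda>T. pt T 0)" "?P (\<lambda>T. pt T 1)" "?P (\<lambda>T. pt T 2)" "?P (\<lambda>T. pt T 3)"
      "?P (\<lambda>T. pt T 4)"
    "?P (\<lambda>T. pt T 5)" "?P (\<lambda>T. pt T 6)"
    using coord[THEN lin] unfolding \<phi>_def pt_simps fst_conv snd_conv .
  have pos: "?P (\<lambda>T. pt T j)" if j: "j \<ge> 0" for j
  proof (cases "j \<le> 6")
    case True
    then consider "j = 0" | "j = 1" | "j = 2" | "j = 3" | "j = 4" | "j = 5" | "j = 6" using j
        by linarith
    then show ?thesis using small by cases simp_all
  qed (simp only: pt_outside zero)
  show ?thesis
  proof (cases "k \<ge> 0")
    case False
    then obtain p q where "real_polynomial_function p" "real_polynomial_function q"
        "\<forall>T\<in>V. Re (pt T (- k)) = p T \<and> Im (pt T (- k)) = q T"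
      using pos[of "- k"] by auto
    then show ?thesis
      by (intro exI[of _ p] exI[of _ "\<lambda>T. - q T"]) (auto simp: pt_simps(8)
          real_polynomial_function_minus)
  qed (rule pos)
qed

lemma mon_polynomial:
  "\<exists>p q. real_polynomial_function p \<and> real_polynomial_function q \<and>
    (\<forall>T\<in>V. Re_mon M T = p T \<and> Im_mon M T = q T)"
proof (induction M)
  case empty
  then show ?case
    by (intro exI[of _ "\<lambda>_. 1"] exI[of _ "\<lambda>_. 0"]) (auto simp: Re_Im_mon_simps intro:
        real_polynomial_function.intros(2))
next
  case (add k M)
  then obtain p q where pq: "real_polynomial_function p" "real_polynomial_function q"
      "\<forall>T\<in>V. Re_mon M T = p T \<and> Im_mon M T = q T"
    by blast
  obtain r s where rs: "real_polynomial_function r" "real_polynomial_function s"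
      "\<forall>T\<in>V. Re (pt T k) = r T \<and> Im (pt T k) = s T"
    using coordinate_polynomial by blast
  show ?case
    using pq rs
    by (intro exI[of _ "\<lambda>T. r T * p T - s T * q T"] exI[of _ "\<lambda>T. r T * q T + s T * p T"] conjI)
      (auto simp: Re_mon_def Im_mon_def intro!: real_polynomial_function_diff
          real_polynomial_function.intros(3,4))
qed

definition representable :: "(12 tensor \<Rightarrow> real) \<Rightarrow> bool"
    where "representable f \<longleftrightarrow> (\<exists>c. represents c f)"

lemma representable_intros:
  "representable (\<lambda>T. r)" "representable f \<Longrightarrow> representable g \<Longrightarrow> representable (\<lambda>T. f T + g T)"
  "representable f \<Longrightarrow> representable g \<Longrightarrow> representable (\<lambda>T. f T * g T)"
  "k \<in> {-6..6} \<Longrightarrow> representable (\<lambda>T. Re (pt T k))" "k \<in> {-6..6} \<Longrightarrow> representable (\<lambda>T. Im (pt T k))"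
proof -
  show "representable (\<lambda>T. r)" unfolding representable_def by (rule exI, rule represents_const)
  show "representable f \<Longrightarrow> representable g \<Longrightarrow> representable (\<lambda>T. f T + g T)"
    unfolding representable_def by (elim exE) (rule exI, rule represents_add)
  show "representable f \<Longrightarrow> representable g \<Longrightarrow> representable (\<lambda>T. f T * g T)"
    unfolding representable_def by (elim exE) (rule exI, rule represents_mult)
  assume "k \<in> {-6..6}"
  then have "representable (Re_mon {#k#})" "representable (Im_mon {#k#})"
    using represents_Re_Im[of "{#k#}"] unfolding representable_def by auto
  then show "representable (\<lambda>T. Re (pt T k))" "representable (\<lambda>T. Im (pt T k))"
    by (simp_all add: Re_mon_def[abs_def] Im_mon_def[abs_def])
qed

text \<open>Conversely, composing a linear form on tensors with \<open>\<psi>\<close> expresses it by real and imaginary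
parts of the coordinates.\<close>

lemma polynomial_representable:
  "real_polynomial_function p \<Longrightarrow> representable p"
proof (induction rule: real_polynomial_function.induct)
  case (linear f)
  define h where "h x = f (\<psi> x)" for x
  have h: "linear h" unfolding h_def
    using linear_compose[OF linear_\<psi> bounded_linear.linear[OF linear]] by (simp add: comp_def)
  let ?e = "\<lambda>i w. ((if i = 0 then 1 else 0, if i = 1 then w else 0, if i = 2 then w else 0, if i =
      3 then w else 0,
    if i = 4 then w else 0, if i = 5 then w else 0, if i = (6::int) then w else 0) :: harm)"
  let ?a = "\<lambda>i. h (?e i 1)" and ?b = "\<lambda>i. h (?e i \<i>)"
  have "h (r, z1, z2, z3, z4, z5, z6) = r * ?a 0 + (Re z1 * ?a 1 + Im z1 * ?b 1) + (Re z2 * ?a 2 +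
      Im z2 * ?b 2) +
      (Re z3 * ?a 3 + Im z3 * ?b 3) + (Re z4 * ?a 4 + Im z4 * ?b 4) + (Re z5 * ?a 5 + Im z5 * ?b 5)
          + (Re z6 * ?a 6 + Im z6 * ?b 6)"
    for r z1 z2 z3 z4 z5 z6
  proof -
    have "(r, z1, z2, z3, z4, z5, z6) = r *\<^sub>R ?e 0 1 + (Re z1 *\<^sub>R ?e 1 1 + Im z1 *\<^sub>R ?e 1 \<i>) +
        (Re z2 *\<^sub>R ?e 2 1 + Im z2 *\<^sub>R ?e 2 \<i>) +
      (Re z3 *\<^sub>R ?e 3 1 + Im z3 *\<^sub>R ?e 3 \<i>) + (Re z4 *\<^sub>R ?e 4 1 + Im z4 *\<^sub>R ?e 4 \<i>) +
      (Re z5 *\<^sub>R ?e 5 1 + Im z5 *\<^sub>R ?e 5 \<i>) + (Re z6 *\<^sub>R ?e 6 1 + Im z6 *\<^sub>R ?e 6 \<i>)"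
      by (simp add: complex_eq_iff)
    then show ?thesis by (simp only: linear_add[OF h] linear_scale[OF h] real_scaleR_def)
  qed
  note h_eq = this
  have eq: "f T = Re (pt T 0) * ?a 0 + (Re (pt T 1) * ?a 1 + Im (pt T 1) * ?b 1) +
      (Re (pt T 2) * ?a 2 + Im (pt T 2) * ?b 2) +
      (Re (pt T 3) * ?a 3 + Im (pt T 3) * ?b 3) + (Re (pt T 4) * ?a 4 + Im (pt T 4) * ?b 4) +
      (Re (pt T 5) * ?a 5 + Im (pt T 5) * ?b 5) + (Re (pt T 6) * ?a 6 + Im (pt T 6) * ?b 6)" if "T \<in>
          V" for T
  proof -
    have "f T = h (l T, z 2 T, z 4 T, z 6 T, z 8 T, z 10 T, z 12 T)"
      using \<psi>(3)[OF that] by (simp add: h_def flip: \<phi>_def)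
    then show ?thesis unfolding h_eq[of "l T" "z 2 T" "z 4 T" "z 6 T" "z 8 T" "z 10 T"
        "z 12 T"] pt_simps Re_complex_of_real .
  qed
  have "representable (\<lambda>T. Re (pt T 0) * ?a 0 + (Re (pt T 1) * ?a 1 + Im (pt T 1) * ?b 1) +
      (Re (pt T 2) * ?a 2 + Im (pt T 2) * ?b 2) +
      (Re (pt T 3) * ?a 3 + Im (pt T 3) * ?b 3) + (Re (pt T 4) * ?a 4 + Im (pt T 4) * ?b 4) +
      (Re (pt T 5) * ?a 5 + Im (pt T 5) * ?b 5) + (Re (pt T 6) * ?a 6 + Im (pt T 6) * ?b 6))"
    by (intro representable_intros) auto
  then obtain c
      where "represents c (\<lambda>T. Re (pt T 0) * ?a 0 + (Re (pt T 1) * ?a 1 + Im (pt T 1) * ?b 1) +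
      (Re (pt T 2) * ?a 2 + Im (pt T 2) * ?b 2) +
      (Re (pt T 3) * ?a 3 + Im (pt T 3) * ?b 3) + (Re (pt T 4) * ?a 4 + Im (pt T 4) * ?b 4) +
      (Re (pt T 5) * ?a 5 + Im (pt T 5) * ?b 5) + (Re (pt T 6) * ?a 6 + Im (pt T 6) * ?b 6))"
    unfolding representable_def by (elim exE)
  then have "represents c f" by (rule represents_cong) (rule eq[symmetric])
  then show ?case unfolding representable_def by blast
qed (simp_all add: representable_intros)

section \<open>The invariants\<close>

lemma Inv_represented:
  assumes "f \<in> Inv V G act"
  obtains c where "represents c f" "f = restrict f V"
proof -
  obtain p where p: "real_polynomial_function p" "f = restrict p V" using assms
      by (auto simp: Inv_def polynomials_on_def)
  then obtain c where "represents c p" using polynomial_representable representable_def by blast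
  then have "represents c f" using p(2) by simp
  then show thesis using that p(2) by simp
qed

text \<open>A rotation multiplies the coefficient of \<open>M\<close> by a character. By uniqueness of coefficients
it must be trivial if the coefficient is nonzero; the angle is chosen such that a nonzero weight
gives \<open>- 1\<close>.\<close>

lemma rot_invariant_balanced:
  assumes c: "represents c f" and inv: "\<And>\<theta> T. T \<in> V \<Longrightarrow> f (tensor_act (rot \<theta>) T) = f T"
  shows "balanced_coeffs c"
  unfolding balanced_coeffs_def
proof (intro allI impI)
  fix M assume M: "c M \<noteq> 0"
  have "sum_mset M = 0"
  proof (rule ccontr)
    assume w: "sum_mset M \<noteq> 0"
    define \<theta> where "\<theta> = pi / (2 * of_int (sum_mset M))"
    let ?d = "\<lambda>N. c N * cis (2 * of_int (sum_mset N) * \<theta>)"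
    have supp: "supp ?d = supp c" by (auto simp: supp_def)
    have "of_real (f T) = evaluate ?d (pt T)" if T: "T \<in> V" for T
    proof -
      have "of_real (f T) = (of_real (f (tensor_act (rot \<theta>) T)) :: complex)" using inv T by simp
      also have "\<dots> = evaluate c (pt (tensor_act (rot \<theta>) T))"
        using c tensor_act_Sym[OF T] by (simp add: represents_def)
      also have "\<dots> = evaluate ?d (pt T)"
        unfolding evaluate_def supp by (simp add: mon_rot[OF T] mult.assoc)
      finally show ?thesis .
    qed
    then have "represents ?d f" using c unfolding represents_def supp by blast
    from fun_cong[OF represents_unique[OF c this], of M] have
        "c M = c M * cis (2 * of_int (sum_mset M) * \<theta>)" .
    also have "2 * of_int (sum_mset M) * \<theta> = pi" using w by (simp add: \<theta>_def)
    finally show False using M by simp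
  qed
  moreover have "set_mset M \<subseteq> {-6..6}" using c M by (auto simp: represents_def supp_def)
  ultimately show "balanced M" by (simp add: balanced_def)
qed

lemma evaluate_neg: "evaluate (\<lambda>M. c (neg M)) y = (\<Sum>M\<in>supp c. c M * mon (neg M) y)"
  unfolding evaluate_def
  by (rule sum.reindex_bij_witness[of _ neg neg]) (auto simp: supp_def)

lemma supp_neg: "finite (supp c) \<Longrightarrow> finite (supp (\<lambda>M. c (neg M)))"
proof -
  have "supp (\<lambda>M. c (neg M)) = neg ` supp c" unfolding supp_def
      by (auto simp: image_iff) (metis neg_simps(3))
  then show "finite (supp c) \<Longrightarrow> finite (supp (\<lambda>M. c (neg M)))" by simp
qed

lemma letters_neg: "set_mset (neg M) \<subseteq> {-6..6} \<longleftrightarrow> set_mset M \<subseteq> {-6..(6::int)}"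
proof -
  have "uminus ` S \<subseteq> {-6..6} \<longleftrightarrow> S \<subseteq> {-6..6}" for S :: "int set" by force
  then show ?thesis by simp
qed

lemma represents_letters: "represents c f \<Longrightarrow> c M \<noteq> 0 \<Longrightarrow> set_mset M \<subseteq> {-6..6}"
  by (simp add: represents_def supp_def)

text \<open>Invariance gives \<open>c (neg M) = c M\<close>, reality of the function gives \<open>c (neg M) = cnj (c M)\<close>.\<close>

lemma reflection_invariant_real:
  assumes c: "represents c f" and inv: "\<And>T. T \<in> V \<Longrightarrow> f (tensor_act (rot 0 ** refl_x) T) = f T"
  shows "Im (c M) = 0"
proof -
  have fin: "finite (supp c)" using c by (simp add: represents_def)
  have "represents (\<lambda>M. c (neg M)) f"
    unfolding represents_def
  proof (intro conjI ballI)
    show "finite (supp (\<lambda>M. c (neg M)))" using fin by (rule supp_neg)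
    show "set_mset M \<subseteq> {-6..6}" if "M \<in> supp (\<lambda>M. c (neg M))" for M
      using represents_letters[OF c, of "neg M"] that letters_neg by (simp add: supp_def)
    fix T assume T: "T \<in> V"
    have "of_real (f T) = (of_real (f (tensor_act (rot 0 ** refl_x) T)) :: complex)" using inv T
        by simp
    also have "\<dots> = evaluate c (pt (tensor_act (rot 0 ** refl_x) T))"
      using c tensor_act_Sym[OF T] by (simp add: represents_def)
    also have "\<dots> = evaluate (\<lambda>M. c (neg M)) (pt T)"
      unfolding evaluate_neg by (simp add: evaluate_def mon_rot[OF T])
    finally show "of_real (f T) = evaluate (\<lambda>M. c (neg M)) (pt T)" .
  qed
  then have sym: "c (neg M) = c M" using represents_unique[OF _ c] by metis
  have "represents (\<lambda>M. cnj (c (neg M))) f"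
    unfolding represents_def
  proof (intro conjI ballI)
    have s: "supp (\<lambda>M. cnj (c (neg M))) = supp (\<lambda>M. c (neg M))" by (simp add: supp_def)
    show "finite (supp (\<lambda>M. cnj (c (neg M))))" unfolding s using fin by (rule supp_neg)
    show "set_mset M \<subseteq> {-6..6}" if "M \<in> supp (\<lambda>M. cnj (c (neg M)))" for M
      using represents_letters[OF c, of "neg M"] that letters_neg by (simp add: supp_def)
    fix T assume T: "T \<in> V"
    have "of_real (f T) = cnj (evaluate c (pt T))" using c T
        by (metis complex_cnj_complex_of_real represents_def)
    also have "\<dots> = (\<Sum>M\<in>supp (\<lambda>M. cnj (c M)). cnj (c M) * mon (neg M) (pt T))"
      by (simp add: evaluate_def supp_def mon_neg[OF pt_real[OF T]])
    also have "\<dots> = evaluate (\<lambda>M. cnj (c (neg M))) (pt T)"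
      using evaluate_neg[of "\<lambda>M. cnj (c M)"] by simp
    finally show "of_real (f T) = evaluate (\<lambda>M. cnj (c (neg M))) (pt T)" .
  qed
  then have "cnj (c (neg M)) = c M" using represents_unique[OF _ c] by metis
  then show ?thesis using sym by (simp add: complex_eq_iff)
qed

lemma Re_Im_mon_act:
  assumes "balanced M" "T \<in> V"
  shows "Re_mon M (tensor_act (rot \<theta>) T) = Re_mon M T"
      "Im_mon M (tensor_act (rot \<theta>) T) = Im_mon M T"
    "Re_mon M (tensor_act (rot \<theta> ** refl_x) T) = Re_mon M T"
        "Im_mon M (tensor_act (rot \<theta> ** refl_x) T) = - Im_mon M T"
  using assms(1) mon_rot[OF assms(2), of M \<theta>] mon_neg[OF pt_real[OF assms(2)], of M]
  by (simp_all add: Re_mon_def Im_mon_def balanced_def)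

lemma mon_scale_Re_Im:
  assumes "T \<in> V"
  shows "Re_mon M (c *\<^sub>R T) = c ^ size M * Re_mon M T"
      "Im_mon M (c *\<^sub>R T) = c ^ size M * Im_mon M T"
  using mon_scale[OF assms, of M c] by (simp_all add: Re_mon_def Im_mon_def flip: of_real_power)

lemma homogeneous_restrict:
  assumes "\<And>T c. T \<in> V \<Longrightarrow> f (c *\<^sub>R T) = c ^ d * f T"
  shows "homogeneous_on V (restrict f V)"
  using assms subspace_scale[OF subspace_Sym] unfolding homogeneous_on_def
      by (intro exI[of _ d]) auto

lemma restrict_Inv:
  assumes "real_polynomial_function p" "\<And>T. T \<in> V \<Longrightarrow> f T = p T"
    "\<And>g T. g \<in> G \<Longrightarrow> T \<in> V \<Longrightarrow> f (tensor_act g T) = f T"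
  shows "restrict f V \<in> Inv V G tensor_act"
proof -
  have "restrict f V = restrict p V" using assms(2) by auto
  then have "restrict f V \<in> polynomials_on V" unfolding polynomials_on_def using assms(1) by blast
  moreover have "restrict f V (tensor_act g T) = restrict f V T" if "g \<in> G" "T \<in> V" for g T
    using assms(3)[OF that] tensor_act_Sym[OF that(2)] that(2) by simp
  ultimately show ?thesis unfolding Inv_def by blast
qed

lemma generator_balanced: "c \<in> set generator_codes \<Longrightarrow> balanced (word c)"
  using generator_atom atom_balanced by blast

lemma Re_mon_Inv:
  assumes "balanced M"
  shows "restrict (Re_mon M) V \<in> Inv V SO2 tensor_act" "restrict (Re_mon M) V \<in> Inv V O2 tensor_act"
proof -
  obtain p where p: "real_polynomial_function p" "\<And>T. T \<in> V \<Longrightarrow> Re_mon M T = p T"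
      using mon_polynomial[of M] by blast
  show "restrict (Re_mon M) V \<in> Inv V SO2 tensor_act"
    by (rule restrict_Inv[OF p]) (auto simp: SO2_eq Re_Im_mon_act[OF assms])
  show "restrict (Re_mon M) V \<in> Inv V O2 tensor_act"
    by (rule restrict_Inv[OF p]) (auto simp: Re_Im_mon_act[OF assms] elim!: O2_cases)
qed

lemma Im_mon_Inv:
  assumes "balanced M"
  shows "restrict (Im_mon M) V \<in> Inv V SO2 tensor_act"
proof -
  obtain p where p: "real_polynomial_function p" "\<And>T. T \<in> V \<Longrightarrow> Im_mon M T = p T"
      using mon_polynomial[of M] by blast
  show ?thesis
    by (rule restrict_Inv[OF p]) (auto simp: SO2_eq Re_Im_mon_act[OF assms])
qed

lemma Im_product_Inv:
  assumes "balanced M" "balanced N"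
  shows "restrict (\<lambda>T. Im_mon M T * Im_mon N T) V \<in> Inv V O2 tensor_act"
proof -
  obtain p where p: "real_polynomial_function p" "\<And>T. T \<in> V \<Longrightarrow> Im_mon M T = p T"
      using mon_polynomial[of M] by blast
  obtain q where q: "real_polynomial_function q" "\<And>T. T \<in> V \<Longrightarrow> Im_mon N T = q T"
      using mon_polynomial[of N] by blast
  show ?thesis
    by (rule restrict_Inv[OF real_polynomial_function.intros(4)[OF p(1) q(1)]])
      (auto simp: p(2) q(2)[symmetric] Re_Im_mon_act[OF assms(1)] Re_Im_mon_act[OF assms(2)] simp
          flip: p(2) elim!: O2_cases)
qed

lemma SO2_family_generates:
  "generated_algebra V (SO2_family ` (set generator_codes <+> set mixed_codes)) =
      Inv V SO2 tensor_act"
    (is "generated_algebra V ?B = _")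
proof
  have "?B \<subseteq> Inv V SO2 tensor_act"
    using Re_mon_Inv(1)[OF generator_balanced] Im_mon_Inv[OF generator_balanced[OF mixed_generator]]
    by (auto simp: SO2_family_def)
  then show "generated_algebra V ?B \<subseteq> Inv V SO2 tensor_act"
    by (rule generated_algebra_subset_Inv) (rule tensor_act_Sym)
  show "Inv V SO2 tensor_act \<subseteq> generated_algebra V ?B"
  proof
    fix f assume f: "f \<in> Inv V SO2 tensor_act"
    then obtain c where c: "represents c f" "f = restrict f V" by (rule Inv_represented)
    have "balanced_coeffs c"
      using f by (intro rot_invariant_balanced[OF c(1)]) (auto simp: Inv_def SO2_eq)
    moreover have "restrict (Re_mon (word d)) V \<in> ?B" if "d \<in> set generator_codes" for d
      using that by (intro image_eqI[of _ _ "Inl d"]) (auto simp: SO2_family_def)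
    moreover have "restrict (Im_mon (word d)) V \<in> ?B" if "d \<in> set mixed_codes" for d
      using that by (intro image_eqI[of _ _ "Inr d"]) (auto simp: SO2_family_def)
    ultimately show "f \<in> generated_algebra V ?B"
      using SO2_monomials_generated[of ?B] by (intro generated_of_represents[OF c]) auto
  qed
qed

lemma O2_family_generates:
  "generated_algebra V (O2_family ` (set generator_codes <+> set exceptional_pairs)) =
      Inv V O2 tensor_act"
    (is "generated_algebra V ?B = _")
proof
  have "O2_family i \<in> Inv V O2 tensor_act" if "i \<in> set generator_codes <+> set exceptional_pairs"
      for i
  proof (cases i)
    case (Inl d)
    then show ?thesis using that Re_mon_Inv(2)[OF generator_balanced] by (auto simp: O2_family_def)
  next
    case (Inr q)
    obtain a b where q: "q = (a, b)" by (cases q)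
    then have "(a, b) \<in> set exceptional_pairs" using that Inr by auto
    then show ?thesis
      using Im_product_Inv[OF generator_balanced[OF mixed_generator]
          generator_balanced[OF mixed_generator]] exceptional_mixed
      by (simp add: O2_family_def Inr q)
  qed
  then have "?B \<subseteq> Inv V O2 tensor_act" by blast
  then show "generated_algebra V ?B \<subseteq> Inv V O2 tensor_act"
    by (rule generated_algebra_subset_Inv) (rule tensor_act_Sym)
  show "Inv V O2 tensor_act \<subseteq> generated_algebra V ?B"
  proof
    fix f assume f: "f \<in> Inv V O2 tensor_act"
    then obtain c where c: "represents c f" "f = restrict f V" by (rule Inv_represented)
    have "balanced_coeffs c"
      using f rot_O2 by (intro rot_invariant_balanced[OF c(1)]) (auto simp: Inv_def)
    moreover have "Im (c M) = 0" for M
      using f rot_O2 by (intro reflection_invariant_real[OF c(1)]) (auto simp: Inv_def)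
    moreover have "restrict (Re_mon (word d)) V \<in> ?B" if "d \<in> set generator_codes" for d
      using that by (intro image_eqI[of _ _ "Inl d"]) (auto simp: O2_family_def)
    moreover have "restrict (\<lambda>T. Im_mon (word a) T * Im_mon (word b) T) V \<in> ?B"
        if "(a, b) \<in> set exceptional_pairs" for a b
      using that by (intro image_eqI[of _ _ "Inr (a, b)"]) (auto simp: O2_family_def)
    ultimately show "f \<in> generated_algebra V ?B"
      using O2_monomials_generated[of ?B] by (intro generated_of_represents[OF c]) auto
  qed
qed

lemma mon_word:
  assumes "c \<in> set mixed_codes"
  shows "mon (word c) (pt T) = monomial_of_code c (\<lambda>k. z k T)"
proof -
  have wf: "well_formed c" using assms atom_codes_well_formed by (simp add: atom_codes_eq)
  have maps: "map (pt T) (fst c) = map (\<lambda>k. z (nat (2 * k)) T) (fst c)"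
    "map (\<lambda>k. pt T (- k)) (snd c) = map (\<lambda>k. cnj (z (nat (2 * k)) T)) (snd c)"
    using well_formed_letters[OF wf] by (auto simp: pt_def)
  show ?thesis by (simp only: word_def mon_simps mon_mset mon_neg_mset monomial_of_code_def maps)
qed

lemma monomials_image:
  "{\<lambda>T. h (m (\<lambda>k. z k T)) | m. m \<in> set monomials} = (\<lambda>c T. h (mon (word c) (pt T))) ` set
      mixed_codes"
proof -
  have "{\<lambda>T. h (m (\<lambda>k. z k T)) | m. m \<in> set monomials} = (\<lambda>c T. h (monomial_of_code c (\<lambda>k. z k T)))
      ` set mixed_codes"
    unfolding monomials_codes by auto
  also have "\<dots> = (\<lambda>c T. h (mon (word c) (pt T))) ` set mixed_codes"
    by (intro image_cong refl) (simp add: mon_word)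
  finally show ?thesis .
qed

lemma common_invariants_image: "common_invariants l z = (\<lambda>c. Re_mon (word c)) ` set generator_codes"
proof -
  have zero: "Re_mon (word ([0], [])) = l" by (simp add: word_def Re_mon_def fun_eq_iff pt_simps)
  have pair_list: "pair_codes = [([1], [1]), ([2], [2]), ([3], [3]), ([4], [4]), ([5], [5]),
      ([6], [6])]"
    by (simp add: pair_codes_def upto_rec1)
  have pairs: "(\<lambda>c. Re_mon (word c)) ` set pair_codes = {\<lambda>T. Re (z k T * cnj (z k T)) | k. k \<in> {2,
      4, 6, 8, 10, 12}}"
    unfolding pair_list by (auto simp: word_def Re_mon_def[abs_def] pt_simps)
  have mixed:
      "(\<lambda>c. Re_mon (word c)) ` set mixed_codes = {\<lambda>T. Re (m (\<lambda>k. z k T)) | m. m \<in> set monomials}"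
    unfolding monomials_image by (simp add: Re_mon_def[abs_def])
  show ?thesis
    unfolding common_invariants_def mixed[symmetric] pairs[symmetric]
    by (simp add: generator_codes_def zero image_Un)
qed

lemma SO2_invariants_family:
  "restrict_all (SO2_invariants l z) V = SO2_family ` (set generator_codes <+> set mixed_codes)"
  unfolding restrict_all_def SO2_invariants_def common_invariants_image monomials_image
  by (simp add: Plus_def image_Un image_image SO2_family_def Im_mon_def[abs_def])

lemma O2_invariants_family:
  "restrict_all (O2_invariants l z) V = O2_family ` (set generator_codes <+> set exceptional_pairs)"
proof -
  let ?prod = "\<lambda>(a, b) T. Im_mon (word a) T * Im_mon (word b) T"
  have exceptional: "?prod ` set exceptional_pairs =
    {\<lambda>T. Im (z 4 T * cnj (z 2 T)^2) * Im (z 12 T * cnj (z 6 T)^2),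
     \<lambda>T. Im (z 12 T * cnj (z 6 T)^2) * Im (z 8 T * cnj (z 4 T)^2),
     \<lambda>T. Im (z 12 T * cnj (z 10 T) * cnj (z 2 T)) * Im (z 8 T * cnj (z 4 T)^2),
     \<lambda>T. Im (z 12 T * cnj (z 6 T)^2) * Im (z 10 T * cnj (z 2 T) * cnj (z 8 T))}"
  proof -
    have "mon (word ([2], [1, 1])) (pt T) = z 4 T * cnj (z 2 T)^2"
      "mon (word ([6], [3, 3])) (pt T) = z 12 T * cnj (z 6 T)^2"
      "mon (word ([4], [2, 2])) (pt T) = z 8 T * cnj (z 4 T)^2"
      "mon (word ([6], [5, 1])) (pt T) = z 12 T * cnj (z 10 T) * cnj (z 2 T)"
      "mon (word ([5], [4, 1])) (pt T) = z 10 T * cnj (z 2 T) * cnj (z 8 T)" for T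
      by (simp_all add: word_def pt_simps power2_eq_square)
    then show ?thesis
        by (simp only: exceptional_pairs_def list.set image_insert image_empty prod.case Im_mon_def)
  qed
  have "restrict_all (O2_invariants l z) V =
      (\<lambda>f. restrict f V) ` ((\<lambda>c. Re_mon (word c)) ` set generator_codes \<union> ?prod ` set
          exceptional_pairs)"
    unfolding restrict_all_def O2_invariants_def common_invariants_image exceptional ..
  also have "\<dots> = O2_family ` (set generator_codes <+> set exceptional_pairs)"
    by (simp add: Plus_def image_Un image_image O2_family_def split_def)
  finally show ?thesis .
qed

lemma distinct_generator_codes: "distinct generator_codes"
  by code_simp

lemma generator_count:
  "card (set generator_codes) = 109" "card (set mixed_codes) = 102"
      "card (set exceptional_pairs) = 4"
proof -
  have "length mixed_codes = 102" "length generator_codes = 109" "length exceptional_pairs = 4"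
    by (simp_all add: generator_codes_def pair_codes_def mixed_codes_def exceptional_pairs_def
        upto_rec1)
  moreover have "distinct mixed_codes" "distinct exceptional_pairs"
    using distinct_codes by (simp_all add: exceptional_pairs_def)
  ultimately show "card (set generator_codes) = 109" "card (set mixed_codes) = 102"
      "card (set exceptional_pairs) = 4"
    using distinct_generator_codes by (simp_all only: distinct_card)
qed

theorem SO2_minimal:
  "minimal_integrity_basis V SO2 tensor_act (restrict_all (SO2_invariants l z) V) \<and>
    card (restrict_all (SO2_invariants l z) V) = 211"
proof -
  let ?I = "set generator_codes <+> set mixed_codes"
  have "minimal_integrity_basis V SO2 tensor_act (SO2_family ` ?I) \<and> card (SO2_family ` ?I) =
      card ?I"
  proof (rule minimal_integrity_basis_family)
    fix i assume i: "i \<in> ?I"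
    show "SO2_family i \<in> Inv V SO2 tensor_act"
      using i SO2_family_generates by (blast intro: generated_algebra.gen)
    show "homogeneous_on V (SO2_family i)"
      using mon_scale_Re_Im by (cases i) (auto simp: SO2_family_def intro: homogeneous_restrict)
  qed (use SO2_family_generates SO2_family_independent in simp_all)
  then show ?thesis by (simp add: SO2_invariants_family card_Plus generator_count)
qed

theorem O2_minimal:
  "minimal_integrity_basis V O2 tensor_act (restrict_all (O2_invariants l z) V) \<and>
    card (restrict_all (O2_invariants l z) V) = 113"
proof -
  let ?I = "set generator_codes <+> set exceptional_pairs"
  have "minimal_integrity_basis V O2 tensor_act (O2_family ` ?I) \<and> card (O2_family ` ?I) = card ?I"
  proof (rule minimal_integrity_basis_family)
    fix i assume i: "i \<in> ?I"
    show "O2_family i \<in> Inv V O2 tensor_act"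
      using i O2_family_generates by (blast intro: generated_algebra.gen)
    have "(\<lambda>(a, b). homogeneous_on V (restrict (\<lambda>T. Im_mon (word a) T * Im_mon (word b) T) V)) q"
        for q
      by (cases q) (auto intro!: homogeneous_restrict[where d =
          "size (word (fst q)) + size (word (snd q))"]
          simp: mon_scale_Re_Im power_add)
    then show "homogeneous_on V (O2_family i)"
      using mon_scale_Re_Im by (cases i) (auto simp: O2_family_def intro: homogeneous_restrict)
  qed (use O2_family_generates O2_family_independent in simp_all)
  then show ?thesis by (simp add: O2_invariants_family card_Plus generator_count)
qed

end

theorem theorem8p14:
  fixes l :: "12 tensor \<Rightarrow> real" and z :: "nat \<Rightarrow> 12 tensor \<Rightarrow> complex"
  assumes "harmonic_decomposition (\<lambda>T. (l T, z 2 T, z 4 T, z 6 T, z 8 T, z 10 T, z 12 T))"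
  shows "minimal_integrity_basis (Sym :: 12 tensor set) SO2 tensor_act
           (restrict_all (SO2_invariants l z) Sym) \<and>
         card (restrict_all (SO2_invariants l z) Sym) = 211 \<and>
         minimal_integrity_basis (Sym :: 12 tensor set) O2 tensor_act
           (restrict_all (O2_invariants l z) Sym) \<and>
         card (restrict_all (O2_invariants l z) Sym) = 113"
proof -
  interpret harmonic_coordinates l z by unfold_locales (rule assms)
  show ?thesis using SO2_minimal O2_minimal by blast
qed

end
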